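(* Let $d\ge 2$ and let $\mathcal{H}_S\cong\mathcal{H}_A\cong\mathbb{C}^d$ be the Hilbert spaces of a system $S$ and an ancilla $A$. Let $\mathcal{E}_{t_1},\mathcal{E}_{t_2}$ be completely positive trace-preserving (CPT) maps on operators on $\mathcal{H}_S$, and let $\rho^{0}_{S+A}$ be an arbitrary density operator on $\mathcal{H}_S\otimes\mathcal{H}_A$. For $j=1,2$ set $$\rho^{(t_j)}_{S+A}=(\mathcal{E}_{t_j}\otimes\mathrm{id}_A)\,\rho^{0}_{S+A},$$ and let $\rho_S(t_1)=\operatorname{tr}_A\rho^{(t_1)}_{S+A}$, $\rho_A(t_1)=\operatorname{tr}_S\rho^{(t_1)}_{S+A}$. Define $$F_\Delta(t_1,t_2)=\min\Big\{\sqrt{2\big(1-\operatorname{tr}\rho_S(t_1)^2\big)},\ \sqrt{2\big(1-\operatorname{tr}\rho_A(t_1)^2\big)}\Big\}-\tilde N\,\max\Big\{\big\|(\rho^{(t_2)}_{S+A})^{T_S}\big\|_1-1,\ \big\|(\rho^{(t_2)}_{S+A})^{T_A}\big\|_1-1\Big\},$$ where $\tilde N=\sqrt{2/(d(d-1))}$, $\|\cdot\|_1$ is the trace norm and $T_S$, $T_A$ denote partial transposition on $S$ resp. $A$, and put $\Delta(t_1,t_2)=\max\{0,-F_\Delta(t_1,t_2)\}$. If $\Delta(t_1,t_2)>0$, then the pair $(\mathcal{E}_{t_1},\mathcal{E}_{t_2})$ is not realizable with classical memory; that is, there do not exist operators $\{K_i\}$ on $\mathcal{H}_S$ and CPT maps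 $\{\Phi_i\}$ on $\mathcal{H}_S$ such that for all operators $\rho$ on $\mathcal{H}_S$ $$\mathcal{E}_{t_1}\rho=\sum_i K_i\rho K_i^\dagger,\qquad \mathcal{E}_{t_2}\rho=\sum_i\Phi_i\big(K_i\rho K_i^\dagger\big).$$
   Context: A pair of CPT maps $(\mathcal{E}_{t_1},\mathcal{E}_{t_2})$ (a "dynamics") on a $d$-dimensional system is called realizable with classical memory if there exist a set of Kraus operators $\{K_i\}$ (with $\sum_i K_i^\dagger K_i=\mathbb{1}$) and CPT maps $\Phi_i$ such that $\mathcal{E}_{t_1}\rho=\sum_i K_i\rho K_i^\dagger$ and $\mathcal{E}_{t_2}\rho=\sum_i\Phi_i(K_i\rho K_i^\dagger)$ for all $\rho$; otherwise it is said to require quantum memory. In the main application $\rho^0_{S+A}$ is the maximally entangled state $|\Psi^+\rangle\langle\Psi^+|$ with $|\Psi^+\rangle=d^{-1/2}\sum_i|i\rangle_S|i\rangle_A$, so that $\rho^{(t_j)}_{S+A}$ is the Choi state of $\mathcal{E}_{t_j}$; the theorem is stated for arbitrary $\rho^0_{S+A}$. *)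

theory Defs
  imports Complex_Main "Jordan_Normal_Form.Matrix"
begin

text \<open>Operators on C^d are d x d complex matrices (type complex mat).
  Operators on H_S (x) H_A = C^d (x) C^d are (d*d) x (d*d) matrices, where the
  product basis vector |i>_S |a>_A has index i*d + a (system factor first).\<close>

definition mtrace :: "complex mat \<Rightarrow> complex" where
  "mtrace A = (\<Sum>i<dim_row A. A $$ (i,i))"

definition adj :: "complex mat \<Rightarrow> complex mat" where
  "adj A = mat (dim_col A) (dim_row A) (\<lambda>(i,j). cnj (A $$ (j,i)))"

definition msum :: "nat \<Rightarrow> 'i set \<Rightarrow> ('i \<Rightarrow> complex mat) \<Rightarrow> complex mat" where
  "msum n I f = mat n n (\<lambda>(r,c). \<Sum>i\<in>I. f i $$ (r,c))"

definition psd :: "nat \<Rightarrow> complex mat \<Rightarrow> bool" where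
  "psd n A \<longleftrightarrow> A \<in> carrier_mat n n \<and>
     (\<forall>v \<in> carrier_vec n.
        let q = (\<Sum>i<n. \<Sum>j<n. cnj (v $ i) * A $$ (i,j) * v $ j)
        in Im q = 0 \<and> Re q \<ge> 0)"

definition density :: "nat \<Rightarrow> complex mat \<Rightarrow> bool" where
  "density n \<rho> \<longleftrightarrow> psd n \<rho> \<and> mtrace \<rho> = 1"

definition ext_id :: "nat \<Rightarrow> nat \<Rightarrow> (complex mat \<Rightarrow> complex mat) \<Rightarrow> complex mat \<Rightarrow> complex mat" where
  "ext_id d n E M = mat (d*n) (d*n) (\<lambda>(r,c).
      E (mat d d (\<lambda>(i,j). M $$ (i*n + r mod n, j*n + c mod n))) $$ (r div n, c div n))"

definition CPT :: "nat \<Rightarrow> (complex mat \<Rightarrow> complex mat) \<Rightarrow> bool" where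
  "CPT d E \<longleftrightarrow>
     (\<forall>A \<in> carrier_mat d d. E A \<in> carrier_mat d d) \<and>
     (\<forall>A \<in> carrier_mat d d. \<forall>B \<in> carrier_mat d d. E (A + B) = E A + E B) \<and>
     (\<forall>A \<in> carrier_mat d d. \<forall>c. E (c \<cdot>\<^sub>m A) = c \<cdot>\<^sub>m E A) \<and>
     (\<forall>n. \<forall>M. psd (d*n) M \<longrightarrow> psd (d*n) (ext_id d n E M)) \<and>
     (\<forall>A \<in> carrier_mat d d. mtrace (E A) = mtrace A)"

definition ptrace_A :: "nat \<Rightarrow> complex mat \<Rightarrow> complex mat" where
  "ptrace_A d \<rho> = mat d d (\<lambda>(i,j). \<Sum>a<d. \<rho> $$ (i*d + a, j*d + a))"

definition ptrace_S :: "nat \<Rightarrow> complex mat \<Rightarrow> complex mat" where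
  "ptrace_S d \<rho> = mat d d (\<lambda>(a,b). \<Sum>i<d. \<rho> $$ (i*d + a, i*d + b))"

definition ptrans_S :: "nat \<Rightarrow> complex mat \<Rightarrow> complex mat" where
  "ptrans_S d \<rho> = mat (d*d) (d*d) (\<lambda>(r,c).
      \<rho> $$ ((c div d)*d + r mod d, (r div d)*d + c mod d))"

definition ptrans_A :: "nat \<Rightarrow> complex mat \<Rightarrow> complex mat" where
  "ptrans_A d \<rho> = mat (d*d) (d*d) (\<lambda>(r,c).
      \<rho> $$ ((r div d)*d + c mod d, (c div d)*d + r mod d))"

text \<open>Trace norm ||A||_1 = tr |A| with |A| = sqrt(A^dagger A) the unique PSD square root.\<close>
definition trace_norm :: "complex mat \<Rightarrow> real" where
  "trace_norm A = Re (mtrace (THE B. psd (dim_col A) B \<and> B * B = adj A * A))"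

definition F_Delta :: "nat \<Rightarrow> (complex mat \<Rightarrow> complex mat) \<Rightarrow> (complex mat \<Rightarrow> complex mat)
    \<Rightarrow> complex mat \<Rightarrow> real" where
  "F_Delta d E1 E2 \<rho>0 =
     (let \<rho>1 = ext_id d d E1 \<rho>0; \<rho>2 = ext_id d d E2 \<rho>0;
          \<rho>S = ptrace_A d \<rho>1; \<rho>A = ptrace_S d \<rho>1;
          Nt = sqrt (2 / (real d * (real d - 1)))
      in min (sqrt (2 * (1 - Re (mtrace (\<rho>S * \<rho>S)))))
             (sqrt (2 * (1 - Re (mtrace (\<rho>A * \<rho>A)))))
         - Nt * max (trace_norm (ptrans_S d \<rho>2) - 1) (trace_norm (ptrans_A d \<rho>2) - 1))"

definition Delta :: "nat \<Rightarrow> (complex mat \<Rightarrow> complex mat) \<Rightarrow> (complex mat \<Rightarrow> complex mat)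
    \<Rightarrow> complex mat \<Rightarrow> real" where
  "Delta d E1 E2 \<rho>0 = max 0 (- F_Delta d E1 E2 \<rho>0)"

definition realizable_classical :: "nat \<Rightarrow> (complex mat \<Rightarrow> complex mat) \<Rightarrow> (complex mat \<Rightarrow> complex mat) \<Rightarrow> bool" where
  "realizable_classical d E1 E2 \<longleftrightarrow>
     (\<exists>(I :: nat set) K \<Phi>. finite I \<and>
        (\<forall>i\<in>I. K i \<in> carrier_mat d d \<and> CPT d (\<Phi> i)) \<and>
        msum d I (\<lambda>i. adj (K i) * K i) = 1\<^sub>m d \<and>
        (\<forall>\<rho> \<in> carrier_mat d d.
           E1 \<rho> = msum d I (\<lambda>i. K i * \<rho> * adj (K i)) \<and>
           E2 \<rho> = msum d I (\<lambda>i. \<Phi> i (K i * \<rho> * adj (K i)))))"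

end

theory Submission
  imports Defs "Jordan_Normal_Form.Schur_Decomposition" "HOL-Analysis.L2_Norm"
begin

text \<open>
  With classical memory, the state at time \<open>t\<^sub>1\<close> is a sum of the positive operators
  \<open>H\<^sub>i = (K\<^sub>i \<otimes> 1) \<rho>\<^sub>0 (K\<^sub>i \<otimes> 1)\<^sup>\<dagger>\<close>, and the state at time \<open>t\<^sub>2\<close> is the sum of the
  \<open>(\<Phi>\<^sub>i \<otimes> id) H\<^sub>i\<close>. Channels on \<open>S\<close> commute with \<open>T\<^sub>A\<close> and do not increase the trace norm of
  Hermitian operators, so the trace norm of the partially transposed state at time \<open>t\<^sub>2\<close> is at
  most the sum of the trace norms of the \<open>H\<^sub>i\<close> after partial transposition.

  Each \<open>H\<^sub>i\<close> is in turn a sum of unnormalised pure states. The partial transpose \<open>A\<close> of the pure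
  state with amplitude matrix \<open>M\<close> satisfies \<open>A\<^sup>2 = M M\<^sup>\<dagger> \<otimes> M\<^sup>\<dagger> M\<close>, hence its trace norm is the
  product of the trace norms of \<open>M\<close> and \<open>M\<^sup>\<dagger>\<close>. Cauchy-Schwarz over the \<open>d (d - 1)\<close> off-diagonal
  pairs of singular values bounds this by \<open>tr G + sqrt (d (d - 1)) sqrt ((tr G)\<^sup>2 - tr G\<^sup>2)\<close> with
  \<open>G = M\<^sup>\<dagger> M\<close>. Finally, \<open>G \<mapsto> sqrt ((tr G)\<^sup>2 - tr G\<^sup>2)\<close> is superadditive on positive
  semidefinite matrices (reverse Cauchy-Schwarz), so both sums are controlled by the reduced
  states at time \<open>t\<^sub>1\<close>.
\<close>

subsection \<open>Adjoints and traces\<close>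

lemma index_mult_mat_sum:
  assumes "A \<in> carrier_mat n m" "B \<in> carrier_mat m k" "i < n" "j < k"
  shows "(A * B) $$ (i,j) = (\<Sum>l<m. A $$ (i,l) * B $$ (l,j))"
  using assms by (auto simp: scalar_prod_def lessThan_atLeast0)

declare index_mult_mat(1) [simp del]

lemma square_mat_closed [simp]:
  assumes "A \<in> carrier_mat n n" "B \<in> carrier_mat n n"
  shows "A * B \<in> carrier_mat n n" "A - B \<in> carrier_mat n n" "A + B \<in> carrier_mat n n"
  using assms by auto

lemmas square_mat_assoc = assoc_mult_mat[of _ n n _ n _ n] for n

lemmas square_mat_distrib =
  add_mult_distrib_mat[of _ n n _ _ n] mult_add_distrib_mat[of _ n n _ n]
  minus_mult_distrib_mat[of _ n n _ _ n] mult_minus_distrib_mat[of _ n n _ n] for n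

lemma adj_carrier [simp]: "A \<in> carrier_mat n m \<Longrightarrow> adj A \<in> carrier_mat m n"
  by (auto simp: adj_def)

lemma dim_adj [simp]: "dim_row (adj A) = dim_col A" "dim_col (adj A) = dim_row A"
  by (simp_all add: adj_def)

lemma index_adj [simp]: "i < dim_col A \<Longrightarrow> j < dim_row A \<Longrightarrow> adj A $$ (i,j) = cnj (A $$ (j,i))"
  by (simp add: adj_def)

lemma adj_adj [simp]: "adj (adj A) = A"
  by (rule eq_matI) auto

lemma adj_mult:
  assumes "A \<in> carrier_mat n m" "B \<in> carrier_mat m k"
  shows "adj (A * B) = adj B * adj A"
proof (rule eq_matI)
  fix i j assume "i < dim_row (adj B * adj A)" "j < dim_col (adj B * adj A)"
  then have ij: "i < k" "j < n" using assms by auto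
  have "adj (A * B) $$ (i,j) = (\<Sum>l<m. cnj (A $$ (j,l) * B $$ (l,i)))"
    using assms ij by (simp add: index_mult_mat_sum[OF assms])
  also have "\<dots> = (\<Sum>l<m. adj B $$ (i,l) * adj A $$ (l,j))"
    using assms ij by (intro sum.cong) auto
  also have "\<dots> = (adj B * adj A) $$ (i,j)"
    using assms ij by (intro index_mult_mat_sum[symmetric]) auto
  finally show "adj (A * B) $$ (i,j) = (adj B * adj A) $$ (i,j)" .
qed (use assms in auto)

lemma adj_minus: "A \<in> carrier_mat n m \<Longrightarrow> B \<in> carrier_mat n m \<Longrightarrow> adj (A - B) = adj A - adj B"
  by (rule eq_matI) auto

lemma cscalar_prod_adj:
  assumes "A \<in> carrier_mat n m" "v \<in> carrier_vec m" "w \<in> carrier_vec n"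
  shows "(A *\<^sub>v v) \<bullet>c w = v \<bullet>c (adj A *\<^sub>v w)"
proof -
  have "(A *\<^sub>v v) \<bullet>c w = (\<Sum>i<n. \<Sum>j<m. v $ j * (A $$ (i,j) * cnj (w $ i)))"
    using assms by (simp add: scalar_prod_def lessThan_atLeast0 sum_distrib_left mult_ac)
  also have "\<dots> = (\<Sum>j<m. \<Sum>i<n. v $ j * (A $$ (i,j) * cnj (w $ i)))" by (rule sum.swap)
  also have "\<dots> = v \<bullet>c (adj A *\<^sub>v w)"
    using assms by (simp add: scalar_prod_def lessThan_atLeast0 sum_distrib_left)
  finally show ?thesis .
qed

lemma index_adj_mult:
  assumes "A \<in> carrier_mat n m" "B \<in> carrier_mat n k" "i < m" "j < k"
  shows "(adj A * B) $$ (i,j) = col B j \<bullet>c col A i"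
  using assms by (simp add: index_mult_mat(1) scalar_prod_def mult.commute)

lemma mtrace_eq_sum: "A \<in> carrier_mat n n \<Longrightarrow> mtrace A = (\<Sum>i<n. A $$ (i,i))"
  by (auto simp: mtrace_def)

lemma mtrace_mult:
  assumes "A \<in> carrier_mat n m" "B \<in> carrier_mat m n"
  shows "mtrace (A * B) = (\<Sum>i<n. \<Sum>j<m. A $$ (i,j) * B $$ (j,i))"
  using assms by (simp add: mtrace_def index_mult_mat_sum[OF assms])

lemma mtrace_mult_commute:
  assumes "A \<in> carrier_mat n m" "B \<in> carrier_mat m n"
  shows "mtrace (A * B) = mtrace (B * A)"
  unfolding mtrace_mult[OF assms] mtrace_mult[OF assms(2,1)]
  by (subst sum.swap) (simp add: mult.commute)

lemma mtrace_add:
  "A \<in> carrier_mat n n \<Longrightarrow> B \<in> carrier_mat n n \<Longrightarrow> mtrace (A + B) = mtrace A + mtrace B"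
  by (auto simp: mtrace_def sum.distrib)

lemma mtrace_minus:
  "A \<in> carrier_mat n n \<Longrightarrow> B \<in> carrier_mat n n \<Longrightarrow> mtrace (A - B) = mtrace A - mtrace B"
  by (auto simp: mtrace_def sum_subtractf)

lemma mtrace_smult: "A \<in> carrier_mat n n \<Longrightarrow> mtrace (c \<cdot>\<^sub>m A) = c * mtrace A"
  by (auto simp: mtrace_def sum_distrib_left)

lemma mtrace_one: "mtrace (1\<^sub>m n) = of_nat n"
  by (simp add: mtrace_def)

lemma mtrace_transpose: "A \<in> carrier_mat n n \<Longrightarrow> mtrace A\<^sup>T = mtrace A"
  by (auto simp: mtrace_def)

subsection \<open>Hermitian and positive semidefinite matrices\<close>

definition hermitian :: "nat \<Rightarrow> complex mat \<Rightarrow> bool" where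
  "hermitian n A \<longleftrightarrow> A \<in> carrier_mat n n \<and> adj A = A"

lemma hermitian_carrier: "hermitian n A \<Longrightarrow> A \<in> carrier_mat n n"
  by (simp add: hermitian_def)

lemma hermitian_adj: "hermitian n A \<Longrightarrow> adj A = A"
  by (simp add: hermitian_def)

lemma hermitian_index_swap: "hermitian n A \<Longrightarrow> i < n \<Longrightarrow> j < n \<Longrightarrow> A $$ (j,i) = cnj (A $$ (i,j))"
  unfolding hermitian_def by (metis index_adj carrier_matD)

lemma hermitian_minus: "hermitian n A \<Longrightarrow> hermitian n B \<Longrightarrow> hermitian n (A - B)"
  by (simp add: hermitian_def adj_minus[of _ n n])

lemma hermitian_eigenvalue_real:
  assumes A: "hermitian n A" and w: "w \<in> carrier_vec n" "w \<noteq> 0\<^sub>v n" "A *\<^sub>v w = a \<cdot>\<^sub>v w"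
  shows "a \<in> \<real>"
proof -
  have "(A *\<^sub>v w) \<bullet>c w = w \<bullet>c (A *\<^sub>v w)"
    using cscalar_prod_adj[OF hermitian_carrier[OF A] w(1,1)] hermitian_adj[OF A] by simp
  then have "a * (w \<bullet>c w) = cnj a * (w \<bullet>c w)"
    using w(1) by (simp add: w(3) conjugate_smult_vec)
  then have "a = cnj a" using w(1,2) by simp
  then show ?thesis using Reals_cnj_iff by metis
qed

lemma psd_iff_cscalar_prod:
  "psd n A \<longleftrightarrow> A \<in> carrier_mat n n \<and> (\<forall>v \<in> carrier_vec n. 0 \<le> (A *\<^sub>v v) \<bullet>c v)"
proof -
  have form: "(\<Sum>i<n. \<Sum>j<n. cnj (v $ i) * A $$ (i,j) * v $ j) = (A *\<^sub>v v) \<bullet>c v"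
    if "A \<in> carrier_mat n n" "v \<in> carrier_vec n" for v
    using that by (simp add: scalar_prod_def lessThan_atLeast0 sum_distrib_left mult_ac)
  have "(let q = z in Im q = 0 \<and> 0 \<le> Re q) \<longleftrightarrow> 0 \<le> z" for z
    by (auto simp: less_eq_complex_def)
  then show ?thesis unfolding psd_def by (simp add: form cong: conj_cong)
qed

lemma psd_carrier: "psd n A \<Longrightarrow> A \<in> carrier_mat n n"
  by (simp add: psd_def)

lemma cscalar_prod_unit_vec:
  fixes A :: "complex mat"
  assumes "A \<in> carrier_mat n n" "i < n" "j < n"
  shows "(A *\<^sub>v unit_vec n j) \<bullet>c unit_vec n i = A $$ (i,j)"
proof -
  have "conjugate (unit_vec n i) = (unit_vec n i :: complex vec)"
    by (rule eq_vecI) (auto simp: unit_vec_def)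
  then show ?thesis using assms by (simp add: scalar_prod_right_unit)
qed

lemma psd_diag_nonneg:
  assumes "psd n A" "i < n" shows "0 \<le> A $$ (i,i)"
  using assms cscalar_prod_unit_vec[of A n i i] unfolding psd_iff_cscalar_prod
  by (metis unit_vec_carrier)

lemma psd_imp_hermitian:
  assumes A: "psd n A" shows "hermitian n A"
proof -
  have carrier: "A \<in> carrier_mat n n" using A by (rule psd_carrier)
  have polar: "0 \<le> A $$ (i,i) + cnj z * A $$ (j,i) + z * A $$ (i,j) + z * cnj z * A $$ (j,j)"
    if ij: "i < n" "j < n" for i j z
  proof -
    let ?e = "unit_vec n i" and ?f = "unit_vec n j"
    have "(A *\<^sub>v (?e + z \<cdot>\<^sub>v ?f)) \<bullet>c (?e + z \<cdot>\<^sub>v ?f) = (A *\<^sub>v ?e) \<bullet>c ?e + cnj z * ((A *\<^sub>v ?e) \<bullet>c ?f)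
        + z * ((A *\<^sub>v ?f) \<bullet>c ?e) + z * cnj z * ((A *\<^sub>v ?f) \<bullet>c ?f)"
      using carrier by (simp add: mult_add_distrib_mat_vec[of _ n n] mult_mat_vec[of _ n n]
          conjugate_add_vec[of _ n] conjugate_smult_vec add_scalar_prod_distrib[of _ n]
          scalar_prod_add_distrib[of _ n] algebra_simps)
    moreover have "0 \<le> (A *\<^sub>v (?e + z \<cdot>\<^sub>v ?f)) \<bullet>c (?e + z \<cdot>\<^sub>v ?f)"
      using A by (simp add: psd_iff_cscalar_prod)
    ultimately show ?thesis by (simp add: cscalar_prod_unit_vec[OF carrier] ij)
  qed
  have "cnj (A $$ (j,i)) = A $$ (i,j)" if ij: "i < n" "j < n" for i j
    using polar[OF ij, of 1] polar[OF ij, of \<i>]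
      psd_diag_nonneg[OF A ij(1)] psd_diag_nonneg[OF A ij(2)]
    by (simp add: less_eq_complex_def complex_eq_iff)
  then show ?thesis using carrier by (auto simp: hermitian_def)
qed

lemma psd_mtrace_nonneg: "psd n A \<Longrightarrow> 0 \<le> mtrace A"
  by (subst mtrace_eq_sum[OF psd_carrier]) (auto intro!: sum_nonneg psd_diag_nonneg)

lemma psd_add:
  assumes "psd n A" "psd n B" shows "psd n (A + B)"
  using assms by (auto simp: psd_iff_cscalar_prod add_mult_distrib_mat_vec[of _ n n]
      add_scalar_prod_distrib[of _ n] mult_mat_vec_carrier[of _ n n])

lemma psd_zero: "psd n (0\<^sub>m n n)"
  by (simp add: psd_def)

lemma psd_one: "psd n (1\<^sub>m n)"
  by (auto simp: psd_iff_cscalar_prod)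

lemma psd_congruence:
  assumes A: "psd n A" and X: "X \<in> carrier_mat m n"
  shows "psd m (X * A * adj X)"
proof -
  have carrier: "A \<in> carrier_mat n n" using A by (rule psd_carrier)
  have "0 \<le> (X * A * adj X *\<^sub>v v) \<bullet>c v" if v: "v \<in> carrier_vec m" for v
  proof -
    have w: "adj X *\<^sub>v v \<in> carrier_vec n" using X v by (intro mult_mat_vec_carrier[of _ n m]) auto
    have "X * A * adj X *\<^sub>v v = X *\<^sub>v (A *\<^sub>v (adj X *\<^sub>v v))"
      using carrier X v w
      by (simp add: assoc_mult_mat_vec[of _ m n _ m] assoc_mult_mat_vec[of _ m n _ n])
    then have "(X * A * adj X *\<^sub>v v) \<bullet>c v = (A *\<^sub>v (adj X *\<^sub>v v)) \<bullet>c (adj X *\<^sub>v v)"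
      using X v carrier w by (simp add: cscalar_prod_adj[of _ m n] mult_mat_vec_carrier[of _ n n])
    then show ?thesis using A w by (simp add: psd_iff_cscalar_prod)
  qed
  moreover have "X * A * adj X \<in> carrier_mat m m"
    using carrier X by (intro mult_carrier_mat[of _ m n]) auto
  ultimately show ?thesis by (simp add: psd_iff_cscalar_prod)
qed

lemma psd_mult_adj: "X \<in> carrier_mat m n \<Longrightarrow> psd m (X * adj X)"
  using psd_congruence[OF psd_one, of X m n] by simp

lemma psd_adj_mult: "X \<in> carrier_mat m n \<Longrightarrow> psd n (adj X * X)"
  using psd_mult_adj[of "adj X" n m] by simp

lemma psd_transpose:
  assumes A: "psd n A" shows "psd n A\<^sup>T"
proof -
  have carrier: "A \<in> carrier_mat n n" using A by (rule psd_carrier)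
  have form: "(A\<^sup>T *\<^sub>v v) \<bullet>c v = (A *\<^sub>v conjugate v) \<bullet>c conjugate v" if v: "v \<in> carrier_vec n" for v
    using transpose_vec_mult_scalar[OF carrier, of "conjugate v" v] carrier v
      comm_scalar_prod[of "A *\<^sub>v conjugate v" n v]
    by (simp add: mult_mat_vec_carrier[of _ n n])
  have "0 \<le> (A *\<^sub>v conjugate v) \<bullet>c conjugate v" if "v \<in> carrier_vec n" for v
    using A that unfolding psd_iff_cscalar_prod by (metis carrier_vec_conjugate)
  then show ?thesis using carrier by (simp add: psd_iff_cscalar_prod form)
qed

subsection \<open>The spectral theorem\<close>

lemma mtrace_similar_mat_wit:
  assumes "similar_mat_wit A B P Q" shows "mtrace A = mtrace B"
proof -
  obtain n where carrier: "A \<in> carrier_mat n n" "B \<in> carrier_mat n n"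
      "P \<in> carrier_mat n n" "Q \<in> carrier_mat n n"
    and QP: "Q * P = 1\<^sub>m n" and A: "A = P * B * Q"
    using assms unfolding similar_mat_wit_def Let_def by auto
  have "mtrace A = mtrace (Q * (P * B))"
    unfolding A using carrier by (intro mtrace_mult_commute[of _ n n]) auto
  also have "Q * (P * B) = B"
    using carrier by (simp add: square_mat_assoc[symmetric, where n = n] QP)
  finally show ?thesis .
qed

lemma exists_nonzero_eigenvalue:
  fixes A :: "complex mat"
  assumes A: "A \<in> carrier_mat n n" and trace_nonzero: "mtrace A \<noteq> 0"
  obtains e where "eigenvalue A e" "e \<noteq> 0"
proof -
  obtain es where es: "char_poly A = (\<Prod>a\<leftarrow>es. [:- a, 1:])"
    using char_poly_factorized[OF A] by blast
  obtain B P Q where "schur_decomposition A es = (B, P, Q)" by (metis prod_cases3)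
  then have sim: "similar_mat_wit A B P Q" and diag: "diag_mat B = es"
    using schur_decomposition[OF A es] by auto
  have "mtrace A = mtrace B" using sim by (rule mtrace_similar_mat_wit)
  also have "\<dots> = sum_list es"
    unfolding diag[symmetric] mtrace_def diag_mat_def
    by (simp add: sum_list_sum_nth atLeast0LessThan)
  finally obtain e where e: "e \<in> set es" "e \<noteq> 0" using trace_nonzero sum_list_neutral by metis
  then have "poly (char_poly A) e = 0"
    unfolding es poly_prod_list by (auto simp: prod_list_zero_iff)
  then have "eigenvalue A e" using eigenvalue_root_char_poly[OF A] by simp
  then show thesis using e(2) by (rule that)
qed

lemma commuting_projection_eigenvector:
  fixes A P :: "complex mat"
  assumes A: "A \<in> carrier_mat n n" and P: "P \<in> carrier_mat n n" "P * P = P"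
    and comm: "A * P = P * A" and trace_nonzero: "mtrace P \<noteq> 0"
  obtains w a where "w \<in> carrier_vec n" "w \<noteq> 0\<^sub>v n" "P *\<^sub>v w = w" "A *\<^sub>v w = a \<cdot>\<^sub>v w"
proof -
  \<comment> \<open>The shift \<open>s\<close> makes the trace of \<open>(A + s) P\<close> nonzero, so that this matrix has a nonzero
    eigenvalue; the corresponding eigenvector lies in the range of \<open>P\<close>.\<close>
  define s where "s = (1 - mtrace (A * P)) / mtrace P"
  define B where "B = A * P + s \<cdot>\<^sub>m P"
  have B: "B \<in> carrier_mat n n" using A P by (simp add: B_def)
  have "mtrace B = 1"
    using A P trace_nonzero by (simp add: B_def mtrace_add[of _ n] mtrace_smult[of _ n] s_def)
  then obtain e where "eigenvalue B e" and e: "e \<noteq> 0"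
    using exists_nonzero_eigenvalue[OF B] by auto
  then obtain w where w: "w \<in> carrier_vec n" "w \<noteq> 0\<^sub>v n" and Bw: "B *\<^sub>v w = e \<cdot>\<^sub>v w"
    using B unfolding eigenvalue_def eigenvector_def by auto
  have "P * (A * P) = A * P"
    using A P comm by (simp add: square_mat_assoc[symmetric, where n = n])
  then have "P * B = B"
    using A P by (simp add: B_def square_mat_distrib[where n = n] mult_smult_distrib[of _ n n _ n])
  then have "P *\<^sub>v (B *\<^sub>v w) = B *\<^sub>v w"
    using B P w by (metis assoc_mult_mat_vec)
  then have "e \<cdot>\<^sub>v (P *\<^sub>v w) = e \<cdot>\<^sub>v w"
    using P w by (simp add: Bw mult_mat_vec[of _ n n])
  then have "inverse e \<cdot>\<^sub>v (e \<cdot>\<^sub>v (P *\<^sub>v w)) = inverse e \<cdot>\<^sub>v (e \<cdot>\<^sub>v w)" by simp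
  then have Pw: "P *\<^sub>v w = w" using e by (simp add: smult_smult_assoc)
  have "B *\<^sub>v w = A *\<^sub>v (P *\<^sub>v w) + s \<cdot>\<^sub>v (P *\<^sub>v w)"
    using A P w by (intro eq_vecI) (auto simp: B_def add_mult_distrib_mat_vec[of _ n n])
  then have shifted: "A *\<^sub>v w + s \<cdot>\<^sub>v w = e \<cdot>\<^sub>v w" by (simp add: Pw Bw)
  have "A *\<^sub>v w = (e - s) \<cdot>\<^sub>v w"
  proof (rule eq_vecI)
    fix i assume "i < dim_vec ((e - s) \<cdot>\<^sub>v w)"
    then show "(A *\<^sub>v w) $ i = ((e - s) \<cdot>\<^sub>v w) $ i"
      using arg_cong[OF shifted, of "\<lambda>v. v $ i"] A w by (simp add: algebra_simps)
  qed (use A w in auto)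
  then show thesis using that w Pw by blast
qed

definition real_diag :: "nat \<Rightarrow> (nat \<Rightarrow> real) \<Rightarrow> complex mat" where
  "real_diag n f = mat_diag n (\<lambda>i. of_real (f i))"

lemma real_diag_carrier [simp]: "real_diag n f \<in> carrier_mat n n"
  by (simp add: real_diag_def)

lemma index_real_diag [simp]:
  "i < n \<Longrightarrow> j < n \<Longrightarrow> real_diag n f $$ (i,j) = (if i = j then of_real (f i) else 0)"
  by (simp add: real_diag_def mat_diag_def)

lemma dim_real_diag [simp]: "dim_row (real_diag n f) = n" "dim_col (real_diag n f) = n"
  by (simp_all add: real_diag_def mat_diag_def)

lemma adj_real_diag: "adj (real_diag n f) = real_diag n f"
  by (rule eq_matI) auto

lemma index_mult_real_diag:
  assumes "A \<in> carrier_mat m n" "i < m" "j < n"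
  shows "(A * real_diag n f) $$ (i,j) = of_real (f j) * A $$ (i,j)"
  using assms by (simp add: real_diag_def mat_diag_mult_right[of _ m n])

lemma index_real_diag_mult:
  assumes "A \<in> carrier_mat n m" "i < n" "j < m"
  shows "(real_diag n f * A) $$ (i,j) = of_real (f i) * A $$ (i,j)"
  using assms by (simp add: real_diag_def mat_diag_mult_left[of _ n m])

lemma real_diag_mult: "real_diag n f * real_diag n g = real_diag n (\<lambda>i. f i * g i)"
  by (simp add: real_diag_def)

lemma real_diag_minus: "real_diag n f - real_diag n g = real_diag n (\<lambda>i. f i - g i)"
  by (rule eq_matI) auto

lemma mtrace_real_diag: "mtrace (real_diag n f) = of_real (\<Sum>i<n. f i)"
  by (simp add: mtrace_def)

lemma psd_real_diag:
  assumes "\<And>i. i < n \<Longrightarrow> 0 \<le> f i" shows "psd n (real_diag n f)"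
proof -
  have "real_diag n f = real_diag n (\<lambda>i. sqrt (f i)) * adj (real_diag n (\<lambda>i. sqrt (f i)))"
    unfolding adj_real_diag real_diag_mult using assms by (intro eq_matI) auto
  then show ?thesis using psd_mult_adj[OF real_diag_carrier, of n] by simp
qed

lemma mult_eq_mult_real_diag_iff:
  assumes A: "A \<in> carrier_mat n n" and U: "U \<in> carrier_mat n k"
  shows "A * U = U * real_diag k l \<longleftrightarrow> (\<forall>j<k. A *\<^sub>v col U j = of_real (l j) \<cdot>\<^sub>v col U j)"
proof -
  have carrier: "A * U \<in> carrier_mat n k" "U * real_diag k l \<in> carrier_mat n k" using A U by auto
  have "col (U * real_diag k l) j = of_real (l j) \<cdot>\<^sub>v col U j" if "j < k" for j
    using that U carrier(2) index_mult_real_diag[OF U _ that, of _ l] by (intro eq_vecI) auto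
  moreover have "A * U = U * real_diag k l \<longleftrightarrow> (\<forall>j<k. col (A * U) j = col (U * real_diag k l) j)"
    using carrier by (metis carrier_matD mat_col_eqI)
  ultimately show ?thesis using col_mult2[OF A U] by simp
qed

definition orthonormal_eigenvectors ::
  "nat \<Rightarrow> complex mat \<Rightarrow> nat \<Rightarrow> complex mat \<Rightarrow> (nat \<Rightarrow> real) \<Rightarrow> bool"
where
  "orthonormal_eigenvectors n A k U l \<longleftrightarrow>
    U \<in> carrier_mat n k \<and> adj U * U = 1\<^sub>m k \<and> A * U = U * real_diag k l"

lemma complement_projection:
  assumes A: "hermitian n A" and U: "orthonormal_eigenvectors n A k U l"
  defines "P \<equiv> 1\<^sub>m n - U * adj U"
  shows "P \<in> carrier_mat n n" "adj U * P = 0\<^sub>m k n" "P * P = P" "A * P = P * A"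
    "mtrace P = of_nat n - of_nat k"
proof -
  have A_carrier: "A \<in> carrier_mat n n"
    and U_carrier: "U \<in> carrier_mat n k" "adj U \<in> carrier_mat k n"
    and UU: "adj U * U = 1\<^sub>m k" and AU: "A * U = U * real_diag k l"
    using A U by (auto simp: hermitian_def orthonormal_eigenvectors_def)
  have Q_carrier: "U * adj U \<in> carrier_mat n n" using U_carrier by auto
  then show P_carrier: "P \<in> carrier_mat n n" by (simp add: P_def)
  have "adj U * (U * adj U) = adj U"
    using U_carrier UU by (simp add: assoc_mult_mat[symmetric, of _ k n _ k _ n])
  then show UP: "adj U * P = 0\<^sub>m k n"
    using U_carrier Q_carrier by (simp add: P_def mult_minus_distrib_mat[of _ k n _ n])
  have "P * P = P - U * (adj U * P)"
    using U_carrier Q_carrier P_carrier by (subst (1) P_def)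
      (simp add: square_mat_distrib[where n = n] assoc_mult_mat[of _ n k _ n _ n])
  also have "\<dots> = P" using U_carrier P_carrier UP by (intro eq_matI) auto
  finally show "P * P = P" .
  have "U * adj U * A = U * adj (A * U)"
    using A_carrier U_carrier hermitian_adj[OF A]
    by (simp add: adj_mult[of _ n n _ k] assoc_mult_mat[of _ n k _ n _ n])
  also have "\<dots> = U * real_diag k l * adj U"
    unfolding AU using U_carrier
    by (simp add: adj_mult[of _ n k _ k] adj_real_diag assoc_mult_mat[of _ n k _ k _ n])
  also have "\<dots> = A * (U * adj U)"
    unfolding AU[symmetric] using A_carrier U_carrier
    by (simp add: assoc_mult_mat[of _ n n _ k _ n])
  finally show "A * P = P * A"
    using A_carrier Q_carrier by (simp add: P_def square_mat_distrib[where n = n])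
  show "mtrace P = of_nat n - of_nat k"
    using Q_carrier mtrace_mult_commute[OF U_carrier]
    by (simp add: P_def mtrace_minus[of _ n] UU mtrace_one)
qed

lemma orthonormal_eigenvectors_append:
  assumes A: "A \<in> carrier_mat n n" and U: "orthonormal_eigenvectors n A k U l"
    and w: "w \<in> carrier_vec n" "w \<bullet>c w = 1" "adj U *\<^sub>v w = 0\<^sub>v k" "A *\<^sub>v w = of_real a \<cdot>\<^sub>v w"
  shows "orthonormal_eigenvectors n A (Suc k) (mat_of_cols n (cols U @ [w])) (l(k := a))"
    (is "orthonormal_eigenvectors n A _ ?W ?m")
proof -
  have U_carrier: "U \<in> carrier_mat n k"
    and UU: "adj U * U = 1\<^sub>m k" and AU: "A * U = U * real_diag k l"
    using U by (auto simp: orthonormal_eigenvectors_def)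
  have W_carrier: "?W \<in> carrier_mat n (Suc k)" using U_carrier by auto
  have col_W: "col ?W j = (if j < k then col U j else w)" if "j < Suc k" for j
    using that U_carrier w(1) by (subst col_mat_of_cols) (auto simp: nth_append)
  have w_orth: "w \<bullet>c col U i = 0" if "i < k" for i
  proof -
    have "(adj U *\<^sub>v w) $ i = w \<bullet>c col U i"
      using that U_carrier w(1) by (simp add: scalar_prod_def mult.commute)
    then show ?thesis using w(3) that by simp
  qed
  have orth_w: "col U i \<bullet>c w = 0" if "i < k" for i
  proof -
    have "col U i \<bullet>c w = conjugate (w \<bullet>c col U i)"
      using that U_carrier w(1) by (simp add: scalar_prod_def mult.commute)
    then show ?thesis using w_orth[OF that] by simp
  qed
  have "adj ?W * ?W = 1\<^sub>m (Suc k)"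
  proof (rule eq_matI)
    fix i j
    assume "i < dim_row (1\<^sub>m (Suc k) :: complex mat)" "j < dim_col (1\<^sub>m (Suc k) :: complex mat)"
    then have ij: "i < Suc k" "j < Suc k" by auto
    have "col U j \<bullet>c col U i = (if i = j then 1 else 0)" if "i < k" "j < k"
      using index_adj_mult[OF U_carrier U_carrier that] that UU by simp
    then show "(adj ?W * ?W) $$ (i,j) = 1\<^sub>m (Suc k) $$ (i,j)"
      unfolding index_adj_mult[OF W_carrier W_carrier ij] using ij w(2) w_orth orth_w
      by (auto simp: col_W less_Suc_eq)
  qed (use W_carrier in auto)
  moreover have "A * ?W = ?W * real_diag (Suc k) ?m"
    using mult_eq_mult_real_diag_iff[OF A U_carrier, of l] AU w(4)
    by (auto simp: mult_eq_mult_real_diag_iff[OF A W_carrier] col_W less_Suc_eq)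
  ultimately show ?thesis using W_carrier by (simp add: orthonormal_eigenvectors_def)
qed

lemma exists_orthogonal_unit_eigenvector:
  assumes A: "hermitian n A" and U: "orthonormal_eigenvectors n A k U l" and "k < n"
  obtains w a where
    "w \<in> carrier_vec n" "w \<bullet>c w = 1" "adj U *\<^sub>v w = 0\<^sub>v k" "A *\<^sub>v w = of_real a \<cdot>\<^sub>v w"
proof -
  have A_carrier: "A \<in> carrier_mat n n" using A by (rule hermitian_carrier)
  have U_carrier: "U \<in> carrier_mat n k" using U by (simp add: orthonormal_eigenvectors_def)
  define P where "P = 1\<^sub>m n - U * adj U"
  note P = complement_projection[OF A U, folded P_def]
  have "mtrace P \<noteq> 0" using P(5) \<open>k < n\<close> by simp
  then obtain v a where v: "v \<in> carrier_vec n" "v \<noteq> 0\<^sub>v n" "P *\<^sub>v v = v" "A *\<^sub>v v = a \<cdot>\<^sub>v v"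
    using commuting_projection_eigenvector[OF A_carrier P(1,3,4)] by blast
  have "adj U *\<^sub>v v = (adj U * P) *\<^sub>v v"
    using U_carrier P(1) v(1,3) by (simp add: assoc_mult_mat_vec[of _ k n _ n])
  then have orth: "adj U *\<^sub>v v = 0\<^sub>v k" using P(2) v(1) by (auto intro: eq_vecI)
  have a: "a = of_real (Re a)"
    using hermitian_eigenvalue_real[OF A v(1,2,4)] by (simp add: complex_is_Real_iff complex_eq_iff)
  define N where "N = Re (v \<bullet>c v)"
  have N: "v \<bullet>c v = of_real N" "0 < N"
    using conjugate_square_greater_0_vec[OF v(1)] v(2)
    by (auto simp: N_def less_complex_def complex_eq_iff)
  define w where "w = complex_of_real (1 / sqrt N) \<cdot>\<^sub>v v"
  show thesis
  proof (rule that[of w "Re a"])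
    show "w \<in> carrier_vec n" using v(1) by (simp add: w_def)
    show "w \<bullet>c w = 1"
      using v(1) N
      by (simp add: w_def conjugate_smult_vec) (simp add: of_real_mult[symmetric] del: of_real_mult)
    show "adj U *\<^sub>v w = 0\<^sub>v k"
      using U_carrier v(1) orth by (simp add: w_def mult_mat_vec[of _ k n]) (auto intro: eq_vecI)
    show "A *\<^sub>v w = of_real (Re a) \<cdot>\<^sub>v w"
      using A_carrier v(1,4) a
      by (simp add: w_def mult_mat_vec[of _ n n] smult_smult_assoc mult.commute)
  qed
qed

lemma exists_orthonormal_eigenvectors:
  assumes A: "hermitian n A" and "k \<le> n"
  shows "\<exists>U l. orthonormal_eigenvectors n A k U l"
  using \<open>k \<le> n\<close>
proof (induction k)
  case 0
  have "orthonormal_eigenvectors n A 0 (0\<^sub>m n 0) l" for l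
    using hermitian_carrier[OF A] by (auto simp: orthonormal_eigenvectors_def)
  then show ?case by blast
next
  case (Suc k)
  then obtain U l where U: "orthonormal_eigenvectors n A k U l" by auto
  have "k < n" using Suc.prems by simp
  then obtain w a where
    "w \<in> carrier_vec n" "w \<bullet>c w = 1" "adj U *\<^sub>v w = 0\<^sub>v k" "A *\<^sub>v w = of_real a \<cdot>\<^sub>v w"
    using exists_orthogonal_unit_eigenvector[OF A U] by blast
  then have "orthonormal_eigenvectors n A (Suc k) (mat_of_cols n (cols U @ [w])) (l(k := a))"
    using hermitian_carrier[OF A] U by (intro orthonormal_eigenvectors_append)
  then show ?case by blast
qed

definition unitary :: "nat \<Rightarrow> complex mat \<Rightarrow> bool" where
  "unitary n U \<longleftrightarrow> U \<in> carrier_mat n n \<and> U * adj U = 1\<^sub>m n \<and> adj U * U = 1\<^sub>m n"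

definition unitary_conj :: "complex mat \<Rightarrow> complex mat \<Rightarrow> complex mat" where
  "unitary_conj U X = adj U * X * U"

definition spectral_mat :: "nat \<Rightarrow> complex mat \<Rightarrow> (nat \<Rightarrow> real) \<Rightarrow> complex mat" where
  "spectral_mat n U f = U * real_diag n f * adj U"

lemma unitaryD:
  assumes "unitary n U"
  shows "U \<in> carrier_mat n n" "adj U \<in> carrier_mat n n" "U * adj U = 1\<^sub>m n" "adj U * U = 1\<^sub>m n"
  using assms by (auto simp: unitary_def)

lemma unitary_conj_minus:
  assumes "unitary n U" "X \<in> carrier_mat n n" "Y \<in> carrier_mat n n"
  shows "unitary_conj U (X - Y) = unitary_conj U X - unitary_conj U Y"
  using unitaryD[OF assms(1)] assms(2,3)
  by (simp add: unitary_conj_def square_mat_distrib[where n = n])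

lemma unitary_conj_mult:
  assumes "unitary n U" "X \<in> carrier_mat n n" "Y \<in> carrier_mat n n"
  shows "unitary_conj U (X * Y) = unitary_conj U X * unitary_conj U Y"
proof -
  note U = unitaryD[OF assms(1)] and assoc = square_mat_assoc[where n = n]
  have "unitary_conj U X * unitary_conj U Y = adj U * X * (U * adj U) * Y * U"
    using U(1,2) assms(2,3) by (simp add: unitary_conj_def assoc)
  also have "\<dots> = unitary_conj U (X * Y)"
    unfolding U(3) using U(1,2) assms(2,3) by (simp add: unitary_conj_def assoc)
  finally show ?thesis ..
qed

lemma mtrace_unitary_conj:
  assumes "unitary n U" "X \<in> carrier_mat n n"
  shows "mtrace (unitary_conj U X) = mtrace X"
proof -
  note U = unitaryD[OF assms(1)]
  have "mtrace (unitary_conj U X) = mtrace (U * (adj U * X))"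
    unfolding unitary_conj_def using U assms(2) by (intro mtrace_mult_commute[of _ n n]) auto
  also have "U * (adj U * X) = X"
    using U assms(2) by (simp add: square_mat_assoc[symmetric, where n = n])
  finally show ?thesis .
qed

lemma psd_unitary_conj: "unitary n U \<Longrightarrow> psd n X \<Longrightarrow> psd n (unitary_conj U X)"
  using psd_congruence[of n X "adj U" n] unitaryD(2)[of n U] by (simp add: unitary_conj_def)

lemma unitary_conj_spectral_mat:
  assumes "unitary n U" shows "unitary_conj U (spectral_mat n U f) = real_diag n f"
proof -
  note U = unitaryD[OF assms] and assoc = square_mat_assoc[where n = n]
  have "unitary_conj U (spectral_mat n U f) = (adj U * U) * real_diag n f * (adj U * U)"
    using U(1,2) by (simp add: unitary_conj_def spectral_mat_def assoc)
  then show ?thesis by (simp add: U(4) left_mult_one_mat[of _ n n] right_mult_one_mat[of _ n n])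
qed

lemma spectral_mat_mult:
  assumes "unitary n U"
  shows "spectral_mat n U f * spectral_mat n U g = spectral_mat n U (\<lambda>i. f i * g i)"
proof -
  note U = unitaryD[OF assms] and assoc = square_mat_assoc[where n = n]
  have "spectral_mat n U f * spectral_mat n U g
      = U * real_diag n f * (adj U * U) * (real_diag n g * adj U)"
    using U(1,2) by (simp add: spectral_mat_def assoc)
  also have "\<dots> = U * (real_diag n f * real_diag n g) * adj U"
    unfolding U(4) using U(1,2) by (simp add: assoc right_mult_one_mat[of _ n n])
  finally show ?thesis by (simp add: real_diag_mult spectral_mat_def)
qed

lemma spectral_mat_minus:
  assumes "unitary n U"
  shows "spectral_mat n U f - spectral_mat n U g = spectral_mat n U (\<lambda>i. f i - g i)"
  using unitaryD[OF assms]
  by (simp add: spectral_mat_def real_diag_minus[symmetric] square_mat_distrib[where n = n])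

lemma mtrace_spectral_mat:
  assumes "unitary n U" shows "mtrace (spectral_mat n U f) = of_real (\<Sum>i<n. f i)"
proof -
  have "spectral_mat n U f \<in> carrier_mat n n"
    using unitaryD[OF assms] by (simp add: spectral_mat_def)
  then show ?thesis
    using mtrace_unitary_conj[OF assms, of "spectral_mat n U f"]
    by (simp add: unitary_conj_spectral_mat[OF assms] mtrace_real_diag)
qed

lemma hermitian_spectral_mat:
  assumes "unitary n U" shows "hermitian n (spectral_mat n U f)"
  using unitaryD[OF assms]
  by (simp add: hermitian_def spectral_mat_def adj_mult[of _ n n _ n] adj_real_diag
      square_mat_assoc[where n = n])

lemma psd_spectral_mat:
  assumes "unitary n U" "\<And>i. i < n \<Longrightarrow> 0 \<le> f i"
  shows "psd n (spectral_mat n U f)"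
  unfolding spectral_mat_def using psd_real_diag[of n f] assms(2) unitaryD(1)[OF assms(1)]
  by (intro psd_congruence) auto

lemma spectral_mat_cong:
  assumes "\<And>i. i < n \<Longrightarrow> f i = g i"
  shows "spectral_mat n U f = spectral_mat n U g"
proof -
  have "real_diag n f = real_diag n g" using assms by (intro eq_matI) auto
  then show ?thesis by (simp add: spectral_mat_def)
qed

theorem hermitian_spectral_decomposition:
  assumes A: "hermitian n A"
  obtains U l where "unitary n U" "A = spectral_mat n U l"
proof -
  obtain U l where "orthonormal_eigenvectors n A n U l"
    using exists_orthonormal_eigenvectors[OF A order.refl] by blast
  then have U: "U \<in> carrier_mat n n" "adj U * U = 1\<^sub>m n" and AU: "A * U = U * real_diag n l"
    by (auto simp: orthonormal_eigenvectors_def)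
  then have UU: "U * adj U = 1\<^sub>m n" using mat_mult_left_right_inverse[OF adj_carrier] by blast
  have "spectral_mat n U l = A * (U * adj U)"
    using hermitian_carrier[OF A] U(1)
    by (simp add: spectral_mat_def AU[symmetric] square_mat_assoc[where n = n])
  then have "A = spectral_mat n U l" using hermitian_carrier[OF A] UU by simp
  then show thesis using that U UU unfolding unitary_def by blast
qed

theorem psd_spectral_decomposition:
  assumes "psd n A"
  obtains U l where "unitary n U" "A = spectral_mat n U l" "\<And>i. i < n \<Longrightarrow> 0 \<le> l i"
proof -
  obtain U l where U: "unitary n U" and A: "A = spectral_mat n U l"
    using hermitian_spectral_decomposition[OF psd_imp_hermitian[OF assms]] .
  have "psd n (real_diag n l)"
    using psd_unitary_conj[OF U assms] by (simp add: A unitary_conj_spectral_mat[OF U])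
  then have "0 \<le> l i" if "i < n" for i
    using psd_diag_nonneg[of n "real_diag n l" i] that by (simp add: less_eq_complex_def)
  with U A show thesis by (rule that)
qed

subsection \<open>Positive square roots and the trace norm\<close>

lemma psd_sqrt_exists:
  assumes "psd n A" obtains B where "psd n B" "B * B = A"
proof -
  obtain U l where U: "unitary n U" and A: "A = spectral_mat n U l" and l: "\<And>i. i < n \<Longrightarrow> 0 \<le> l i"
    using psd_spectral_decomposition[OF assms] by blast
  let ?B = "spectral_mat n U (\<lambda>i. sqrt (l i))"
  have "?B * ?B = A"
    unfolding A spectral_mat_mult[OF U] using l by (intro spectral_mat_cong) auto
  moreover have "psd n ?B" using U l by (intro psd_spectral_mat) auto
  ultimately show thesis using that by blast
qed

lemma psd_minus_eq_real_diag_zero: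
  assumes B: "psd n B" and C: "psd n C" and eq: "B * B = C * C"
    and diff: "B - C = real_diag n l" and i: "i < n"
  shows "l i = 0"
proof -
  \<comment> \<open>The diagonal of \<open>(B - C) (B + C) + (B + C) (B - C) = 2 (B\<^sup>2 - C\<^sup>2) = 0\<close> reads
    \<open>l\<^sub>i (B\<^sub>i\<^sub>i + C\<^sub>i\<^sub>i) = 0\<close>.\<close>
  note carrier = psd_carrier[OF B] psd_carrier[OF C]
  let ?L = "real_diag n l" and ?S = "B + C"
  have "(?L * ?S) $$ (i,i) + (?S * ?L) $$ (i,i) = 2 * ((B * B) $$ (i,i) - (C * C) $$ (i,i))"
    unfolding diff[symmetric] using carrier i
    by (simp add: square_mat_distrib[where n = n])
  then have "of_real (l i) * (B $$ (i,i) + C $$ (i,i)) = 0"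
    using index_real_diag_mult[of ?S n n i i l] index_mult_real_diag[of ?S n n i i l] carrier i
    by (simp add: eq)
  moreover have "of_real (l i) = B $$ (i,i) - C $$ (i,i)"
    using arg_cong[OF diff, of "\<lambda>X. X $$ (i,i)"] carrier i by simp
  ultimately show ?thesis
    using psd_diag_nonneg[OF B i] psd_diag_nonneg[OF C i] by (auto simp: add_nonneg_eq_0_iff)
qed

lemma psd_sqrt_unique:
  assumes B: "psd n B" and C: "psd n C" and eq: "B * B = C * C"
  shows "B = C"
proof -
  note carrier = psd_carrier[OF B] psd_carrier[OF C]
  obtain U l where U: "unitary n U" and D: "B - C = spectral_mat n U l"
    using hermitian_spectral_decomposition hermitian_minus psd_imp_hermitian B C by metis
  have "l i = 0" if "i < n" for i
  proof (rule psd_minus_eq_real_diag_zero)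
    show "unitary_conj U B * unitary_conj U B = unitary_conj U C * unitary_conj U C"
      using carrier U eq by (simp add: unitary_conj_mult[symmetric])
    show "unitary_conj U B - unitary_conj U C = real_diag n l"
      using unitary_conj_minus[OF U carrier] by (simp add: D unitary_conj_spectral_mat[OF U])
  qed (use U B C that in \<open>auto intro: psd_unitary_conj\<close>)
  then have "B - C = spectral_mat n U (\<lambda>i. 0 - 0)" unfolding D by (intro spectral_mat_cong) simp
  also have "\<dots> = 0\<^sub>m n n"
    unfolding spectral_mat_minus[OF U, symmetric]
    using hermitian_carrier[OF hermitian_spectral_mat[OF U]] by simp
  finally have "B - C = 0\<^sub>m n n" .
  moreover have "B = (B - C) + C" using carrier by (intro eq_matI) auto
  ultimately show ?thesis using carrier by simp
qed

lemma trace_norm_eqI: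
  assumes "A \<in> carrier_mat m n" "psd n B" "B * B = adj A * A"
  shows "trace_norm A = Re (mtrace B)"
proof -
  have "(THE B. psd (dim_col A) B \<and> B * B = adj A * A) = B"
    using assms psd_sqrt_unique by (intro the_equality) auto
  then show ?thesis by (simp add: trace_norm_def)
qed

lemma trace_norm_psd_sqrt:
  assumes "A \<in> carrier_mat m n"
  obtains B where "psd n B" "B * B = adj A * A" "trace_norm A = Re (mtrace B)"
proof -
  obtain B where "psd n B" "B * B = adj A * A"
    using psd_sqrt_exists[OF psd_adj_mult[OF assms]] .
  then show thesis using that trace_norm_eqI[OF assms] by blast
qed

lemma trace_norm_spectral_mat:
  assumes U: "unitary n U" shows "trace_norm (spectral_mat n U l) = (\<Sum>i<n. \<bar>l i\<bar>)"
proof -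
  have herm: "hermitian n (spectral_mat n U l)" using U by (rule hermitian_spectral_mat)
  have "trace_norm (spectral_mat n U l) = Re (mtrace (spectral_mat n U (\<lambda>i. \<bar>l i\<bar>)))"
    using U hermitian_adj[OF herm]
    by (intro trace_norm_eqI[OF hermitian_carrier[OF herm]])
      (auto simp: psd_spectral_mat spectral_mat_mult)
  then show ?thesis by (simp add: mtrace_spectral_mat[OF U])
qed

lemma trace_norm_minus_le:
  assumes P: "psd n P" and Q: "psd n Q"
  shows "trace_norm (P - Q) \<le> Re (mtrace P) + Re (mtrace Q)"
proof -
  have carrier: "P \<in> carrier_mat n n" "Q \<in> carrier_mat n n" using P Q psd_carrier by auto
  obtain U l where U: "unitary n U" and D: "P - Q = spectral_mat n U l"
    using hermitian_spectral_decomposition hermitian_minus psd_imp_hermitian P Q by metis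
  let ?P = "unitary_conj U P" and ?Q = "unitary_conj U Q"
  have PQ: "psd n ?P" "psd n ?Q" using psd_unitary_conj U P Q by auto
  have carrier': "?P \<in> carrier_mat n n" "?Q \<in> carrier_mat n n" using PQ psd_carrier by auto
  have diff: "real_diag n l = ?P - ?Q"
    using unitary_conj_minus[OF U carrier] by (simp add: D unitary_conj_spectral_mat[OF U])
  have "\<bar>l i\<bar> \<le> Re (?P $$ (i,i)) + Re (?Q $$ (i,i))" if i: "i < n" for i
    using arg_cong[OF diff, of "\<lambda>X. Re (X $$ (i,i))"]
      psd_diag_nonneg[OF PQ(1) i] psd_diag_nonneg[OF PQ(2) i] carrier' i
    by (auto simp: less_eq_complex_def)
  then have "(\<Sum>i<n. \<bar>l i\<bar>) \<le> (\<Sum>i<n. Re (?P $$ (i,i)) + Re (?Q $$ (i,i)))"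
    by (intro sum_mono) auto
  also have "\<dots> = Re (mtrace ?P) + Re (mtrace ?Q)"
    by (simp add: mtrace_eq_sum[OF carrier'(1)] mtrace_eq_sum[OF carrier'(2)] sum.distrib)
  finally show ?thesis
  by (simp add: D trace_norm_spectral_mat[OF U] mtrace_unitary_conj[OF U] carrier)
qed

theorem hermitian_Jordan_decomposition:
  assumes "hermitian n A"
  obtains P Q where "psd n P" "psd n Q" "A = P - Q" "trace_norm A = Re (mtrace P) + Re (mtrace Q)"
proof -
  obtain U l where U: "unitary n U" and A: "A = spectral_mat n U l"
    using hermitian_spectral_decomposition[OF assms] .
  let ?P = "spectral_mat n U (\<lambda>i. max (l i) 0)" and ?Q = "spectral_mat n U (\<lambda>i. max (- l i) 0)"
  have "A = ?P - ?Q"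
    unfolding A spectral_mat_minus[OF U] by (intro spectral_mat_cong) auto
  moreover have "psd n ?P" "psd n ?Q" using U by (auto intro: psd_spectral_mat)
  moreover have "trace_norm A = Re (mtrace ?P) + Re (mtrace ?Q)"
    unfolding A trace_norm_spectral_mat[OF U] mtrace_spectral_mat[OF U] Re_complex_of_real
      sum.distrib[symmetric]
    by (intro sum.cong) auto
  ultimately show thesis using that by blast
qed

lemma trace_norm_triangle:
  assumes "hermitian n A" "hermitian n B"
  shows "trace_norm (A + B) \<le> trace_norm A + trace_norm B"
proof -
  obtain P Q where P: "psd n P" and Q: "psd n Q" and A: "A = P - Q"
    and norm_A: "trace_norm A = Re (mtrace P) + Re (mtrace Q)"
    using hermitian_Jordan_decomposition[OF assms(1)] .
  obtain R S where R: "psd n R" and S: "psd n S" and B: "B = R - S"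
    and norm_B: "trace_norm B = Re (mtrace R) + Re (mtrace S)"
    using hermitian_Jordan_decomposition[OF assms(2)] .
  note carrier = P[THEN psd_carrier] Q[THEN psd_carrier] R[THEN psd_carrier] S[THEN psd_carrier]
  have "A + B = (P + R) - (Q + S)" unfolding A B using carrier by (intro eq_matI) auto
  then have "trace_norm (A + B) \<le> Re (mtrace (P + R)) + Re (mtrace (Q + S))"
    using trace_norm_minus_le[OF psd_add[OF P R] psd_add[OF Q S]] by simp
  then show ?thesis unfolding norm_A norm_B using carrier by (simp add: mtrace_add[of _ n])
qed

lemma trace_norm_transpose_le:
  assumes "hermitian n A" shows "trace_norm A\<^sup>T \<le> trace_norm A"
proof -
  obtain P Q where P: "psd n P" and Q: "psd n Q" and A: "A = P - Q"
    and norm_A: "trace_norm A = Re (mtrace P) + Re (mtrace Q)"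
    using hermitian_Jordan_decomposition[OF assms] .
  note carrier = P[THEN psd_carrier] Q[THEN psd_carrier]
  have "A\<^sup>T = P\<^sup>T - Q\<^sup>T" unfolding A using carrier by (intro eq_matI) auto
  then show ?thesis
    using trace_norm_minus_le[OF psd_transpose[OF P] psd_transpose[OF Q]] carrier
    by (simp add: norm_A mtrace_transpose[of _ n])
qed

subsection \<open>Finite sums of matrices\<close>

lemma msum_carrier [simp]: "msum n I f \<in> carrier_mat n n"
  by (simp add: msum_def)

lemma dim_msum [simp]: "dim_row (msum n I f) = n" "dim_col (msum n I f) = n"
  by (simp_all add: msum_def)

lemma index_msum [simp]: "i < n \<Longrightarrow> j < n \<Longrightarrow> msum n I f $$ (i,j) = (\<Sum>k\<in>I. f k $$ (i,j))"
  by (simp add: msum_def)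

lemma msum_empty: "msum n {} f = 0\<^sub>m n n"
  by (rule eq_matI) auto

lemma msum_insert:
  assumes "finite I" "i \<notin> I" "f i \<in> carrier_mat n n"
  shows "msum n (insert i I) f = f i + msum n I f"
  using assms by (intro eq_matI) auto

lemma msum_cong: "(\<And>i. i \<in> I \<Longrightarrow> f i = g i) \<Longrightarrow> msum n I f = msum n I g"
  by (simp add: msum_def cong: sum.cong)

lemma mtrace_msum:
  assumes "\<And>i. i \<in> I \<Longrightarrow> f i \<in> carrier_mat n n"
  shows "mtrace (msum n I f) = (\<Sum>i\<in>I. mtrace (f i))"
proof -
  have "mtrace (msum n I f) = (\<Sum>r<n. \<Sum>i\<in>I. f i $$ (r,r))"
    by (simp add: mtrace_def)
  also have "\<dots> = (\<Sum>i\<in>I. \<Sum>r<n. f i $$ (r,r))" by (rule sum.swap)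
  also have "\<dots> = (\<Sum>i\<in>I. mtrace (f i))"
    using assms by (intro sum.cong refl mtrace_eq_sum[symmetric]) auto
  finally show ?thesis .
qed

lemma psd_msum:
  assumes "finite I" "\<And>i. i \<in> I \<Longrightarrow> psd n (f i)" shows "psd n (msum n I f)"
  using assms
  by (induction rule: finite_induct)
    (simp_all add: msum_empty psd_zero msum_insert psd_carrier psd_add)

lemma hermitian_msum:
  assumes "\<And>i. i \<in> I \<Longrightarrow> hermitian n (f i)" shows "hermitian n (msum n I f)"
proof -
  have "cnj (\<Sum>k\<in>I. f k $$ (j,i)) = (\<Sum>k\<in>I. f k $$ (i,j))" if "i < n" "j < n" for i j
    unfolding cnj_sum using assms that
    by (intro sum.cong) (simp_all add: hermitian_index_swap[of n _ i j])
  then show ?thesis by (auto simp: hermitian_def)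
qed

lemma trace_norm_msum_le:
  assumes "finite I" "\<And>i. i \<in> I \<Longrightarrow> hermitian n (f i)"
  shows "trace_norm (msum n I f) \<le> (\<Sum>i\<in>I. trace_norm (f i))"
  using assms
proof (induction rule: finite_induct)
  case empty
  show ?case
    using trace_norm_minus_le[OF psd_zero psd_zero, of n]
    by (simp add: msum_empty mtrace_def minus_r_inv_mat[of _ n n])
next
  case (insert i I)
  then have herm: "hermitian n (f i)" "hermitian n (msum n I f)" by (auto intro: hermitian_msum)
  then show ?case
    using trace_norm_triangle[OF herm] insert by (simp add: msum_insert hermitian_carrier)
qed

subsection \<open>Product indices and Kronecker products\<close>

lemma product_index_less:
  fixes i a d n :: nat assumes "i < d" "a < n" shows "i * n + a < d * n"
proof -
  have "i * n + a < Suc i * n" using assms by simp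
  also have "\<dots> \<le> d * n" using assms by (intro mult_right_mono) auto
  finally show ?thesis .
qed

lemma product_index_cases:
  fixes r d n :: nat assumes "r < d * n"
  obtains i a where "r = i * n + a" "i < d" "a < n"
proof -
  have "r div n < d" using assms by (simp add: less_mult_imp_div_less)
  moreover have "r mod n < n" using assms by (cases "n = 0") auto
  ultimately show thesis using that[of "r div n" "r mod n"] by simp
qed

lemma eq_mat_productI:
  assumes "A \<in> carrier_mat (d * n) (e * m)" "B \<in> carrier_mat (d * n) (e * m)"
    and entry: "\<And>i a j b. i < d \<Longrightarrow> a < n \<Longrightarrow> j < e \<Longrightarrow> b < m \<Longrightarrow>
      A $$ (i * n + a, j * m + b) = B $$ (i * n + a, j * m + b)"
  shows "A = B"
proof (rule eq_matI)
  fix r c assume "r < dim_row B" "c < dim_col B"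
  then have "r < d * n" "c < e * m" using assms by auto
  then show "A $$ (r,c) = B $$ (r,c)" by (metis product_index_cases entry)
qed (use assms in auto)

lemma sum_product_index:
  fixes d n :: nat
  shows "(\<Sum>r<d * n. f r) = (\<Sum>i<d. \<Sum>a<n. f (i * n + a))"
proof -
  have "sum f {i * n..<i * n + n} = (\<Sum>a<n. f (i * n + a))" for i
    using sum.shift_bounds_nat_ivl[of f 0 "i * n" n] by (simp add: add.commute lessThan_atLeast0)
  then show ?thesis by (simp only: sum.nat_group[symmetric])
qed

definition kron :: "complex mat \<Rightarrow> complex mat \<Rightarrow> complex mat" where
  "kron A B = mat (dim_row A * dim_row B) (dim_col A * dim_col B)
    (\<lambda>(r,c). A $$ (r div dim_row B, c div dim_col B) * B $$ (r mod dim_row B, c mod dim_col B))"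

lemma kron_carrier [simp]:
  "A \<in> carrier_mat n m \<Longrightarrow> B \<in> carrier_mat k l \<Longrightarrow> kron A B \<in> carrier_mat (n * k) (m * l)"
  by (auto simp: kron_def)

lemma index_kron:
  assumes "A \<in> carrier_mat n m" "B \<in> carrier_mat k l" "i < n" "a < k" "j < m" "b < l"
  shows "kron A B $$ (i * k + a, j * l + b) = A $$ (i,j) * B $$ (a,b)"
  using assms by (simp add: kron_def product_index_less)

lemma adj_kron:
  assumes "A \<in> carrier_mat n m" "B \<in> carrier_mat k l"
  shows "adj (kron A B) = kron (adj A) (adj B)"
proof (rule eq_mat_productI)
  show "adj (kron A B) \<in> carrier_mat (m * l) (n * k)"
    "kron (adj A) (adj B) \<in> carrier_mat (m * l) (n * k)"
    using assms by auto
  fix i a j b assume "i < m" "a < l" "j < n" "b < k"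
  then show "adj (kron A B) $$ (i * l + a, j * k + b)
      = kron (adj A) (adj B) $$ (i * l + a, j * k + b)"
    using assms carrier_matD[OF kron_carrier[OF assms]]
    by (simp add: index_kron[of _ m n _ l k] index_kron[of _ n m _ k l] product_index_less)
qed

lemma kron_mult:
  assumes A: "A \<in> carrier_mat n m" and A': "A' \<in> carrier_mat m p"
    and B: "B \<in> carrier_mat k l" and B': "B' \<in> carrier_mat l q"
  shows "kron A B * kron A' B' = kron (A * A') (B * B')"
proof (rule eq_mat_productI)
  have AB: "kron A B \<in> carrier_mat (n * k) (m * l)"
    and AB': "kron A' B' \<in> carrier_mat (m * l) (p * q)"
    using A A' B B' by auto
  then show "kron A B * kron A' B' \<in> carrier_mat (n * k) (p * q)" by auto
  show "kron (A * A') (B * B') \<in> carrier_mat (n * k) (p * q)"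
    using A A' B B' by (intro kron_carrier) auto
  fix i a j b assume ij: "i < n" "a < k" "j < p" "b < q"
  have "(kron A B * kron A' B') $$ (i * k + a, j * q + b)
      = (\<Sum>s<m. \<Sum>t<l. kron A B $$ (i * k + a, s * l + t) * kron A' B' $$ (s * l + t, j * q + b))"
    using ij
    by (subst index_mult_mat_sum[OF AB AB']) (auto simp: product_index_less sum_product_index)
  also have "\<dots> = (\<Sum>s<m. \<Sum>t<l. (A $$ (i,s) * A' $$ (s,j)) * (B $$ (a,t) * B' $$ (t,b)))"
    using ij by (intro sum.cong refl) (simp add: index_kron[OF A B] index_kron[OF A' B'])
  also have "\<dots> = (A * A') $$ (i,j) * (B * B') $$ (a,b)"
    using ij by (simp add: index_mult_mat_sum[OF A A'] index_mult_mat_sum[OF B B'] sum_product)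
  also have "\<dots> = kron (A * A') (B * B') $$ (i * k + a, j * q + b)"
    using ij A A' B B' by (intro index_kron[symmetric]) auto
  finally show "(kron A B * kron A' B') $$ (i * k + a, j * q + b)
    = kron (A * A') (B * B') $$ (i * k + a, j * q + b)" .
qed

lemma mtrace_kron:
  assumes A: "A \<in> carrier_mat n n" and B: "B \<in> carrier_mat m m"
  shows "mtrace (kron A B) = mtrace A * mtrace B"
  using mtrace_eq_sum[OF kron_carrier[OF A B]]
  by (simp add: sum_product_index index_kron[OF A B] mtrace_eq_sum[OF A] mtrace_eq_sum[OF B]
      sum_product)

lemma psd_kron:
  assumes "psd n A" "psd m B" shows "psd (n * m) (kron A B)"
proof -
  obtain X where X: "psd n X" "X * X = A" using psd_sqrt_exists[OF assms(1)] .
  obtain Y where Y: "psd m Y" "Y * Y = B" using psd_sqrt_exists[OF assms(2)] .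
  have carrier: "X \<in> carrier_mat n n" "Y \<in> carrier_mat m m" using X Y psd_carrier by auto
  have adj: "adj X = X" "adj Y = Y" using X Y psd_imp_hermitian hermitian_adj by auto
  have "kron A B = kron X Y * adj (kron X Y)"
    using carrier by (simp add: adj_kron[OF carrier] adj kron_mult[of _ n n _ n _ m m _ m] X Y)
  then show ?thesis using psd_mult_adj[OF kron_carrier[OF carrier]] by simp
qed

subsection \<open>Channels on the first tensor factor\<close>

definition ancilla_block :: "nat \<Rightarrow> nat \<Rightarrow> complex mat \<Rightarrow> nat \<Rightarrow> nat \<Rightarrow> complex mat" where
  "ancilla_block d n M a b = mat d d (\<lambda>(i,j). M $$ (i * n + a, j * n + b))"

lemma ancilla_block_carrier [simp]: "ancilla_block d n M a b \<in> carrier_mat d d"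
  by (simp add: ancilla_block_def)

lemma dim_ancilla_block [simp]:
  "dim_row (ancilla_block d n M a b) = d" "dim_col (ancilla_block d n M a b) = d"
  by (simp_all add: ancilla_block_def)

lemma index_ancilla_block [simp]:
  "i < d \<Longrightarrow> j < d \<Longrightarrow> ancilla_block d n M a b $$ (i,j) = M $$ (i * n + a, j * n + b)"
  by (simp add: ancilla_block_def)

lemma ext_id_carrier [simp]: "ext_id d n E M \<in> carrier_mat (d * n) (d * n)"
  by (simp add: ext_id_def)

lemma index_ext_id:
  assumes "i < d" "a < n" "j < d" "b < n"
  shows "ext_id d n E M $$ (i * n + a, j * n + b) = E (ancilla_block d n M a b) $$ (i,j)"
  using assms by (simp add: ext_id_def ancilla_block_def product_index_less)

lemma ancilla_block_ext_id:
  assumes "E (ancilla_block d n M a b) \<in> carrier_mat d d" "a < n" "b < n"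
  shows "ancilla_block d n (ext_id d n E M) a b = E (ancilla_block d n M a b)"
  using assms by (intro eq_matI) (auto simp: index_ext_id)

lemma ext_id_comp:
  assumes "\<And>X. X \<in> carrier_mat d d \<Longrightarrow> F X \<in> carrier_mat d d"
  shows "ext_id d n (\<lambda>X. E (F X)) M = ext_id d n E (ext_id d n F M)"
  by (rule eq_mat_productI[OF ext_id_carrier ext_id_carrier])
    (simp add: index_ext_id ancilla_block_ext_id assms)

lemma ext_id_eq_msum:
  assumes "\<And>X. X \<in> carrier_mat d d \<Longrightarrow> E X = msum d I (\<lambda>i. F i X)"
  shows "ext_id d n E M = msum (d * n) I (\<lambda>i. ext_id d n (F i) M)"
  by (rule eq_mat_productI[OF ext_id_carrier msum_carrier])
    (simp add: index_ext_id product_index_less assms)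

lemma CPT_carrier: "CPT d E \<Longrightarrow> A \<in> carrier_mat d d \<Longrightarrow> E A \<in> carrier_mat d d"
  by (simp add: CPT_def)

lemma CPT_psd_ext_id: "CPT d E \<Longrightarrow> psd (d * n) M \<Longrightarrow> psd (d * n) (ext_id d n E M)"
  by (simp add: CPT_def)

lemma CPT_minus:
  assumes E: "CPT d E" and A: "A \<in> carrier_mat d d" and B: "B \<in> carrier_mat d d"
  shows "E (A - B) = E A - E B"
proof -
  have "A - B = A + (- 1) \<cdot>\<^sub>m B" using A B by (intro eq_matI) auto
  then have "E (A - B) = E A + (- 1) \<cdot>\<^sub>m E B" using assms unfolding CPT_def by simp
  also have "\<dots> = E A - E B"
    using CPT_carrier[OF E A] CPT_carrier[OF E B] by (intro eq_matI) auto
  finally show ?thesis .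
qed

lemma ext_id_minus:
  assumes E: "CPT d E"
    and M: "M \<in> carrier_mat (d * n) (d * n)" and N: "N \<in> carrier_mat (d * n) (d * n)"
  shows "ext_id d n E (M - N) = ext_id d n E M - ext_id d n E N"
proof (rule eq_mat_productI[OF ext_id_carrier])
  show "ext_id d n E M - ext_id d n E N \<in> carrier_mat (d * n) (d * n)" by simp
  fix i a j b assume ij: "i < d" "a < n" "j < d" "b < n"
  have "ancilla_block d n (M - N) a b = ancilla_block d n M a b - ancilla_block d n N a b"
    using M N ij by (intro eq_matI) (auto simp: ancilla_block_def product_index_less)
  then show "ext_id d n E (M - N) $$ (i * n + a, j * n + b)
      = (ext_id d n E M - ext_id d n E N) $$ (i * n + a, j * n + b)"
    using ij CPT_carrier[OF E ancilla_block_carrier, of n N a b]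
      carrier_matD[OF ext_id_carrier[of d n E N]]
    by (simp add: index_ext_id product_index_less CPT_minus[OF E])
qed

lemma mtrace_ext_id:
  assumes E: "CPT d E" and M: "M \<in> carrier_mat (d * n) (d * n)"
  shows "mtrace (ext_id d n E M) = mtrace M"
proof -
  have sum_blocks: "mtrace N = (\<Sum>a<n. mtrace (ancilla_block d n N a a))"
    if "N \<in> carrier_mat (d * n) (d * n)" for N
    unfolding mtrace_eq_sum[OF that] sum_product_index mtrace_eq_sum[OF ancilla_block_carrier]
    by (subst sum.swap) simp
  have "mtrace (ext_id d n E M) = (\<Sum>a<n. mtrace (E (ancilla_block d n M a a)))"
    unfolding sum_blocks[OF ext_id_carrier]
    by (intro sum.cong refl) (simp add: ancilla_block_ext_id CPT_carrier[OF E])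
  also have "\<dots> = mtrace M"
    using E unfolding sum_blocks[OF M] by (simp add: CPT_def)
  finally show ?thesis .
qed

lemma
  assumes E: "CPT d E" and A: "hermitian (d * n) A"
  shows hermitian_ext_id: "hermitian (d * n) (ext_id d n E A)"
    and trace_norm_ext_id_le: "trace_norm (ext_id d n E A) \<le> trace_norm A"
proof -
  obtain P Q where P: "psd (d * n) P" and Q: "psd (d * n) Q" and A_eq: "A = P - Q"
    and norm_A: "trace_norm A = Re (mtrace P) + Re (mtrace Q)"
    using hermitian_Jordan_decomposition[OF A] .
  note carrier = P[THEN psd_carrier] Q[THEN psd_carrier]
  note psd_EP = CPT_psd_ext_id[OF E P] and psd_EQ = CPT_psd_ext_id[OF E Q]
  have diff: "ext_id d n E A = ext_id d n E P - ext_id d n E Q"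
    unfolding A_eq by (rule ext_id_minus[OF E carrier])
  then show "hermitian (d * n) (ext_id d n E A)"
    using hermitian_minus psd_imp_hermitian psd_EP psd_EQ by metis
  show "trace_norm (ext_id d n E A) \<le> trace_norm A"
    using trace_norm_minus_le[OF psd_EP psd_EQ]
    by (simp add: diff norm_A mtrace_ext_id[OF E] carrier)
qed

lemma index_kron_one_mult:
  assumes K: "K \<in> carrier_mat p q" and "M \<in> carrier_mat (q * n) m" and "i < p" "a < n" "c < m"
  shows "(kron K (1\<^sub>m n) * M) $$ (i * n + a, c) = (\<Sum>k<q. K $$ (i,k) * M $$ (k * n + a, c))"
proof -
  have "(kron K (1\<^sub>m n) * M) $$ (i * n + a, c)
      = (\<Sum>k<q. \<Sum>b<n. kron K (1\<^sub>m n) $$ (i * n + a, k * n + b) * M $$ (k * n + b, c))"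
    using assms by (subst index_mult_mat_sum[of _ "p * n" "q * n" _ m])
      (auto simp: product_index_less sum_product_index)
  also have "\<dots> = (\<Sum>k<q. \<Sum>b<n. if b = a then K $$ (i,k) * M $$ (k * n + a, c) else 0)"
    using assms by (intro sum.cong refl) (auto simp: index_kron[OF K one_carrier_mat])
  finally show ?thesis using \<open>a < n\<close> by simp
qed

lemma ext_id_conjugation:
  assumes K: "K \<in> carrier_mat d d" and M: "M \<in> carrier_mat (d * n) (d * n)"
  shows "ext_id d n (\<lambda>X. K * X * adj K) M = kron K (1\<^sub>m n) * M * adj (kron K (1\<^sub>m n))"
proof (rule eq_mat_productI[OF ext_id_carrier])
  let ?L = "kron K (1\<^sub>m n)"
  have L: "?L \<in> carrier_mat (d * n) (d * n)" using K by simp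
  then show "?L * M * adj ?L \<in> carrier_mat (d * n) (d * n)" using M by simp
  fix i a j b assume ij: "i < d" "a < n" "j < d" "b < n"
  have LM_carrier: "adj (?L * M) \<in> carrier_mat (d * n) (d * n)" using L M by simp
  have "(?L * M * adj ?L) $$ (i * n + a, j * n + b)
      = adj (?L * adj (?L * M)) $$ (i * n + a, j * n + b)"
    using L M by (simp add: adj_mult[OF L LM_carrier])
  also have "\<dots> = cnj ((?L * adj (?L * M)) $$ (j * n + b, i * n + a))"
    using ij L LM_carrier by (intro index_adj) (auto simp: product_index_less)
  also have "\<dots> = (\<Sum>l<d. cnj (K $$ (j,l)) * (?L * M) $$ (i * n + a, l * n + b))"
    unfolding index_kron_one_mult[OF K LM_carrier ij(3,4) product_index_less[OF ij(1,2)]] cnj_sum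
    using ij L M by (intro sum.cong refl) (auto simp: product_index_less)
  also have "\<dots> = (\<Sum>l<d. cnj (K $$ (j,l)) * (K * ancilla_block d n M a b) $$ (i,l))"
    using ij K by (intro sum.cong refl) (simp add: index_kron_one_mult[OF K M] product_index_less
        index_mult_mat_sum[OF K ancilla_block_carrier])
  also have "\<dots> = (K * ancilla_block d n M a b * adj K) $$ (i,j)"
    using ij K by (subst index_mult_mat_sum[of _ d d _ d]) (auto simp: mult.commute)
  finally show "ext_id d n (\<lambda>X. K * X * adj K) M $$ (i * n + a, j * n + b)
      = (?L * M * adj ?L) $$ (i * n + a, j * n + b)"
    using index_ext_id[OF ij] by simp
qed

lemma psd_ext_id_conjugation:
  assumes "K \<in> carrier_mat d d" "psd (d * n) M"
  shows "psd (d * n) (ext_id d n (\<lambda>X. K * X * adj K) M)"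
  using assms psd_congruence[OF assms(2) kron_carrier[OF assms(1) one_carrier_mat]]
  by (simp add: ext_id_conjugation psd_carrier)

subsection \<open>The purity gap\<close>

definition purity_gap :: "complex mat \<Rightarrow> real" where
  "purity_gap G = (Re (mtrace G))\<^sup>2 - Re (mtrace (G * G))"

lemma square_sum_minus_sum_squares:
  fixes f :: "'a \<Rightarrow> 'b :: comm_ring_1"
  assumes "finite I"
  shows "(\<Sum>i\<in>I. f i)\<^sup>2 - (\<Sum>i\<in>I. (f i)\<^sup>2) = (\<Sum>(i,j)\<in>(SIGMA i:I. I - {i}). f i * f j)"
proof -
  have "(\<Sum>(i,j)\<in>(SIGMA i:I. I - {i}). f i * f j) = (\<Sum>i\<in>I. \<Sum>j\<in>I - {i}. f i * f j)"
    using assms by (simp add: sum.Sigma)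
  also have "\<dots> = (\<Sum>i\<in>I. f i * (\<Sum>j\<in>I. f j) - (f i)\<^sup>2)"
    using assms by (intro sum.cong refl)
      (simp add: sum_distrib_left[symmetric] sum_diff1 power2_eq_square algebra_simps)
  also have "\<dots> = (\<Sum>i\<in>I. f i)\<^sup>2 - (\<Sum>i\<in>I. (f i)\<^sup>2)"
    by (simp add: sum_subtractf sum_distrib_right[symmetric] power2_eq_square)
  finally show ?thesis ..
qed

lemma square_sum_le_offdiagonal:
  fixes f :: "'a \<Rightarrow> real"
  assumes "finite I" and nonneg: "\<And>i. i \<in> I \<Longrightarrow> 0 \<le> f i"
  shows "(\<Sum>i\<in>I. f i)\<^sup>2 \<le> (\<Sum>i\<in>I. (f i)\<^sup>2)
    + sqrt (real (card I) * (real (card I) - 1)) * sqrt ((\<Sum>i\<in>I. (f i)\<^sup>2)\<^sup>2 - (\<Sum>i\<in>I. ((f i)\<^sup>2)\<^sup>2))"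
proof -
  let ?S = "SIGMA i:I. I - {i}"
  note offdiag = square_sum_minus_sum_squares[OF assms(1)]
  have card: "real (card I) * (real (card I) - 1) = real (card ?S)"
    using offdiag[of "\<lambda>_. 1 :: real"] by (simp add: power2_eq_square algebra_simps split_def)
  have "(\<Sum>i\<in>I. f i)\<^sup>2 - (\<Sum>i\<in>I. (f i)\<^sup>2) = (\<Sum>p\<in>?S. \<bar>1\<bar> * \<bar>f (fst p) * f (snd p)\<bar>)"
    unfolding offdiag split_def using nonneg by (intro sum.cong refl) auto
  also have "\<dots> \<le> L2_set (\<lambda>_. 1) ?S * L2_set (\<lambda>p. f (fst p) * f (snd p)) ?S"
    by (rule L2_set_mult_ineq)
  also have "L2_set (\<lambda>_. 1) ?S = sqrt (real (card I) * (real (card I) - 1))"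
    unfolding card by (simp add: L2_set_def)
  also have "L2_set (\<lambda>p. f (fst p) * f (snd p)) ?S = sqrt ((\<Sum>i\<in>I. (f i)\<^sup>2)\<^sup>2 - (\<Sum>i\<in>I. ((f i)\<^sup>2)\<^sup>2))"
    unfolding offdiag L2_set_def split_def by (simp add: power_mult_distrib)
  finally show ?thesis by simp
qed

lemma psd_square_mtrace_le:
  assumes "psd n R"
  shows "(Re (mtrace R))\<^sup>2 \<le> Re (mtrace (R * R))
    + sqrt (real n * (real n - 1)) * sqrt (purity_gap (R * R))"
proof -
  obtain U l where U: "unitary n U" and R: "R = spectral_mat n U l" and l: "\<And>i. i < n \<Longrightarrow> 0 \<le> l i"
    using psd_spectral_decomposition[OF assms] by blast
  show ?thesis
    using square_sum_le_offdiagonal[of "{..<n}" l] l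
    unfolding R purity_gap_def spectral_mat_mult[OF U] mtrace_spectral_mat[OF U]
    by (simp add: power2_eq_square)
qed

lemma square_trace_norm_le:
  assumes "M \<in> carrier_mat m n"
  shows "(trace_norm M)\<^sup>2 \<le> Re (mtrace (adj M * M))
    + sqrt (real n * (real n - 1)) * sqrt (purity_gap (adj M * M))"
proof -
  obtain B where "psd n B" "B * B = adj M * M" "trace_norm M = Re (mtrace B)"
    using trace_norm_psd_sqrt[OF assms] .
  then show ?thesis using psd_square_mtrace_le[of n B] by simp
qed

lemma purity_gap_nonneg:
  assumes "psd n G" shows "0 \<le> purity_gap G"
proof -
  obtain U l where U: "unitary n U" and G: "G = spectral_mat n U l" and l: "\<And>i. i < n \<Longrightarrow> 0 \<le> l i"
    using psd_spectral_decomposition[OF assms] by blast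
  have "0 \<le> (\<Sum>i<n. l i)\<^sup>2 - (\<Sum>i<n. (l i)\<^sup>2)"
    unfolding square_sum_minus_sum_squares[OF finite_lessThan] using l by (intro sum_nonneg) auto
  then show ?thesis
    unfolding G purity_gap_def spectral_mat_mult[OF U] mtrace_spectral_mat[OF U]
    by (simp add: power2_eq_square)
qed

lemma purity_gap_mult_commute:
  assumes A: "A \<in> carrier_mat n m" and B: "B \<in> carrier_mat m n"
  shows "purity_gap (A * B) = purity_gap (B * A)"
proof -
  have "mtrace ((A * B) * (A * B)) = mtrace (A * (B * A * B))"
    using A B by (simp add: assoc_mult_mat[of _ n m _ n _ n] assoc_mult_mat[of _ m n _ m _ n])
  also have "\<dots> = mtrace ((B * A * B) * A)"
    using A B by (intro mtrace_mult_commute[of _ n m]) auto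
  also have "\<dots> = mtrace ((B * A) * (B * A))"
    using A B by (simp add: assoc_mult_mat[of _ m n _ m _ n] assoc_mult_mat[of _ m n _ n _ m]
        assoc_mult_mat[of _ n m _ n _ m] assoc_mult_mat[of _ m n _ m _ m])
  finally show ?thesis using mtrace_mult_commute[OF A B] by (simp add: purity_gap_def)
qed

lemma purity_gap_transpose:
  assumes "G \<in> carrier_mat n n" shows "purity_gap G\<^sup>T = purity_gap G"
proof -
  have "mtrace (G\<^sup>T * G\<^sup>T) = mtrace (G * G)"
    using assms mtrace_transpose[of "G * G" n] by (simp add: transpose_mult[of _ n n _ n])
  then show ?thesis by (simp add: purity_gap_def mtrace_transpose[OF assms])
qed

lemma hermitian_mtrace_square:
  assumes "hermitian n A"
  shows "Re (mtrace (A * A)) = (\<Sum>p\<in>{..<n} \<times> {..<n}. (cmod (A $$ p))\<^sup>2)"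
proof -
  have "Re (A $$ (i,j) * A $$ (j,i)) = (cmod (A $$ (i,j)))\<^sup>2" if "i < n" "j < n" for i j
    by (simp add: hermitian_index_swap[OF assms that] cmod_power2) (simp add: power2_eq_square)
  then show ?thesis
    unfolding mtrace_mult[OF assms[THEN hermitian_carrier] assms[THEN hermitian_carrier]] Re_sum
    by (subst sum.cartesian_product) (auto intro!: sum.cong)
qed

lemma hermitian_mtrace_Cauchy_Schwarz:
  assumes A: "hermitian n A" and B: "hermitian n B"
  shows "Re (mtrace (A * B)) \<le> sqrt (Re (mtrace (A * A))) * sqrt (Re (mtrace (B * B)))"
proof -
  let ?S = "{..<n} \<times> {..<n}"
  have "Re (A $$ (i,j) * B $$ (j,i)) \<le> \<bar>cmod (A $$ (i,j))\<bar> * \<bar>cmod (B $$ (i,j))\<bar>"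
    if "i < n" "j < n" for i j
    using complex_Re_le_cmod[of "A $$ (i,j) * B $$ (j,i)"] hermitian_index_swap[OF B that]
    by (simp add: norm_mult)
  then have "Re (mtrace (A * B)) \<le> (\<Sum>p\<in>?S. \<bar>cmod (A $$ p)\<bar> * \<bar>cmod (B $$ p)\<bar>)"
    unfolding mtrace_mult[OF A[THEN hermitian_carrier] B[THEN hermitian_carrier]] Re_sum
    by (subst sum.cartesian_product) (auto intro!: sum_mono)
  also have "\<dots> \<le> L2_set (\<lambda>p. cmod (A $$ p)) ?S * L2_set (\<lambda>p. cmod (B $$ p)) ?S"
    by (rule L2_set_mult_ineq)
  finally show ?thesis
    unfolding hermitian_mtrace_square[OF A] hermitian_mtrace_square[OF B] L2_set_def .
qed

lemma reverse_Cauchy_Schwarz_sqrt: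
  fixes a b x y p :: real
  assumes "0 \<le> x" "x \<le> a" "0 \<le> y" "y \<le> b" "p \<le> x * y"
  shows "sqrt (a\<^sup>2 - x\<^sup>2) + sqrt (b\<^sup>2 - y\<^sup>2) \<le> sqrt ((a + b)\<^sup>2 - (x\<^sup>2 + 2 * p + y\<^sup>2))"
proof (rule real_le_rsqrt)
  have nonneg: "0 \<le> a\<^sup>2 - x\<^sup>2" "0 \<le> b\<^sup>2 - y\<^sup>2" using assms by (auto intro!: power_mono)
  have "0 \<le> (a * y - b * x)\<^sup>2" by simp
  then have "(a\<^sup>2 - x\<^sup>2) * (b\<^sup>2 - y\<^sup>2) \<le> (a * b - x * y)\<^sup>2"
    by (simp add: power2_eq_square algebra_simps)
  moreover have "x * y \<le> a * b" using assms by (intro mult_mono) auto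
  ultimately have "sqrt ((a\<^sup>2 - x\<^sup>2) * (b\<^sup>2 - y\<^sup>2)) \<le> a * b - x * y"
    by (intro real_le_lsqrt) auto
  then have "sqrt (a\<^sup>2 - x\<^sup>2) * sqrt (b\<^sup>2 - y\<^sup>2) \<le> a * b - p"
    using assms(5) by (simp add: real_sqrt_mult)
  then show "(sqrt (a\<^sup>2 - x\<^sup>2) + sqrt (b\<^sup>2 - y\<^sup>2))\<^sup>2 \<le> (a + b)\<^sup>2 - (x\<^sup>2 + 2 * p + y\<^sup>2)"
    using nonneg by (simp add: power2_sum)
qed

lemma sqrt_purity_gap_superadditive:
  assumes G: "psd n G" and H: "psd n H"
  shows "sqrt (purity_gap G) + sqrt (purity_gap H) \<le> sqrt (purity_gap (G + H))"
proof -
  note carrier = G[THEN psd_carrier] H[THEN psd_carrier]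
  define frob where "frob X = sqrt (Re (mtrace (X * X)))" for X
  have frob_square: "(frob X)\<^sup>2 = Re (mtrace (X * X))" if "psd n X" for X
    unfolding frob_def hermitian_mtrace_square[OF psd_imp_hermitian[OF that]]
    by (simp add: sum_nonneg)
  have frob_nonneg: "0 \<le> frob X" if "psd n X" for X
    unfolding frob_def hermitian_mtrace_square[OF psd_imp_hermitian[OF that]]
    by (simp add: sum_nonneg)
  have gap: "purity_gap X = (Re (mtrace X))\<^sup>2 - (frob X)\<^sup>2" if "psd n X" for X
    unfolding purity_gap_def frob_square[OF that] ..
  have frob_le: "frob X \<le> Re (mtrace X)" if X: "psd n X" for X
  proof (rule power2_le_imp_le)
    show "(frob X)\<^sup>2 \<le> (Re (mtrace X))\<^sup>2" using purity_gap_nonneg[OF X] gap[OF X] by simp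
    show "0 \<le> Re (mtrace X)" using psd_mtrace_nonneg[OF X] by (simp add: less_eq_complex_def)
  qed
  have "(G + H) * (G + H) = (G * G + H * G) + (G * H + H * H)"
    using carrier by (simp add: square_mat_distrib[where n = n])
  then have "mtrace ((G + H) * (G + H)) = mtrace (G * G) + 2 * mtrace (G * H) + mtrace (H * H)"
    using carrier mtrace_mult_commute[OF carrier(2,1)] by (simp add: mtrace_add[of _ n])
  then have "purity_gap (G + H)
      = (Re (mtrace G) + Re (mtrace H))\<^sup>2 - ((frob G)\<^sup>2 + 2 * Re (mtrace (G * H)) + (frob H)\<^sup>2)"
    using carrier
    by (simp add: purity_gap_def mtrace_add[of _ n] frob_square[OF G] frob_square[OF H])
  moreover have "Re (mtrace (G * H)) \<le> frob G * frob H"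
    unfolding frob_def using G H by (intro hermitian_mtrace_Cauchy_Schwarz psd_imp_hermitian)
  ultimately show ?thesis
    using reverse_Cauchy_Schwarz_sqrt[OF frob_nonneg frob_le frob_nonneg frob_le, OF G G H H]
    by (simp add: gap[OF G] gap[OF H])
qed

lemma sqrt_purity_gap_msum:
  assumes "finite J" "\<And>j. j \<in> J \<Longrightarrow> psd n (G j)"
  shows "(\<Sum>j\<in>J. sqrt (purity_gap (G j))) \<le> sqrt (purity_gap (msum n J G))"
  using assms
proof (induction rule: finite_induct)
  case empty
  then show ?case by (simp add: msum_empty purity_gap_def mtrace_def)
next
  case (insert j J)
  then have psd: "psd n (G j)" "psd n (msum n J G)" by (auto intro: psd_msum)
  show ?case
    using sqrt_purity_gap_superadditive[OF psd] insert psd_carrier[OF psd(1)]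
    by (simp add: msum_insert)
qed

subsection \<open>Partial transposes and partial traces\<close>

lemma ptrans_A_carrier [simp]: "ptrans_A d M \<in> carrier_mat (d * d) (d * d)"
  by (simp add: ptrans_A_def)

lemma index_ptrans_A:
  assumes "i < d" "a < d" "j < d" "b < d"
  shows "ptrans_A d M $$ (i * d + a, j * d + b) = M $$ (i * d + b, j * d + a)"
  using assms by (simp add: ptrans_A_def product_index_less)

lemma ptrans_S_eq_transpose: "ptrans_S d M = (ptrans_A d M)\<^sup>T"
  by (rule eq_matI) (auto simp: ptrans_S_def ptrans_A_def)

lemma ptrans_A_msum: "ptrans_A d (msum (d * d) J f) = msum (d * d) J (\<lambda>j. ptrans_A d (f j))"
  by (rule eq_mat_productI[OF ptrans_A_carrier msum_carrier])
    (simp add: index_ptrans_A product_index_less)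

lemma hermitian_ptrans_A:
  assumes "hermitian (d * d) M" shows "hermitian (d * d) (ptrans_A d M)"
proof -
  have "adj (ptrans_A d M) = ptrans_A d M"
  proof (rule eq_mat_productI)
    fix i a j b assume "i < d" "a < d" "j < d" "b < d"
    then show "adj (ptrans_A d M) $$ (i * d + a, j * d + b)
        = ptrans_A d M $$ (i * d + a, j * d + b)"
      using hermitian_index_swap[OF assms, of "j * d + a" "i * d + b"]
        carrier_matD[OF ptrans_A_carrier[of d M]]
      by (simp add: index_ptrans_A product_index_less)
  qed simp_all
  then show ?thesis by (simp add: hermitian_def)
qed

lemma ptrans_A_ext_id: "ptrans_A d (ext_id d d E M) = ext_id d d E (ptrans_A d M)"
proof (rule eq_mat_productI[OF ptrans_A_carrier ext_id_carrier])
  fix i a j b assume ij: "i < d" "a < d" "j < d" "b < d"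
  have "ancilla_block d d (ptrans_A d M) a b = ancilla_block d d M b a"
    using ij by (intro eq_matI) (auto simp: index_ptrans_A)
  then show "ptrans_A d (ext_id d d E M) $$ (i * d + a, j * d + b)
      = ext_id d d E (ptrans_A d M) $$ (i * d + a, j * d + b)"
    using ij by (simp add: index_ptrans_A index_ext_id)
qed

lemma mtrace_ptrace:
  assumes "M \<in> carrier_mat (d * d) (d * d)" "ptr \<in> {ptrace_A d, ptrace_S d}"
  shows "mtrace (ptr M) = mtrace M"
proof -
  have "mtrace (ptrace_A d M) = mtrace M"
    unfolding mtrace_eq_sum[OF assms(1)] sum_product_index by (simp add: mtrace_def ptrace_A_def)
  moreover have "mtrace (ptrace_S d M) = mtrace M"
    unfolding mtrace_eq_sum[OF assms(1)] sum_product_index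
    by (subst sum.swap) (simp add: mtrace_def ptrace_S_def)
  ultimately show ?thesis using assms(2) by auto
qed

lemma ptrace_msum:
  assumes "ptr \<in> {ptrace_A d, ptrace_S d}"
  shows "ptr (msum (d * d) J f) = msum d J (\<lambda>j. ptr (f j))"
proof -
  have "ptrace_A d (msum (d * d) J f) = msum d J (\<lambda>j. ptrace_A d (f j))"
    by (rule eq_matI) (auto simp: ptrace_A_def product_index_less sum.swap[of _ J])
  moreover have "ptrace_S d (msum (d * d) J f) = msum d J (\<lambda>j. ptrace_S d (f j))"
    by (rule eq_matI) (auto simp: ptrace_S_def product_index_less sum.swap[of _ J])
  ultimately show ?thesis using assms by auto
qed

subsection \<open>Pure states\<close>

text \<open>The matrix \<open>M\<close> stands for the vector with amplitude \<open>M $$ (i,a)\<close> at \<open>|i>\<^sub>S |a>\<^sub>A\<close>.\<close>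

definition vec_proj :: "nat \<Rightarrow> complex mat \<Rightarrow> complex mat" where
  "vec_proj d M = mat (d * d) (d * d)
    (\<lambda>(r,c). M $$ (r div d, r mod d) * cnj (M $$ (c div d, c mod d)))"

lemma vec_proj_carrier [simp]: "vec_proj d M \<in> carrier_mat (d * d) (d * d)"
  by (simp add: vec_proj_def)

lemma index_vec_proj [simp]:
  assumes "i < d" "a < d" "j < d" "b < d"
  shows "vec_proj d M $$ (i * d + a, j * d + b) = M $$ (i,a) * cnj (M $$ (j,b))"
  using assms by (simp add: vec_proj_def product_index_less)

lemma hermitian_vec_proj: "hermitian (d * d) (vec_proj d M)"
  by (auto simp: hermitian_def adj_def vec_proj_def)

lemma psd_vec_proj_decomposition:
  assumes "psd (d * d) H"
  obtains N where "\<And>k. N k \<in> carrier_mat d d" "H = msum (d * d) {..<d * d} (\<lambda>k. vec_proj d (N k))"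
proof -
  obtain B where B: "psd (d * d) B" "B * B = H" using psd_sqrt_exists[OF assms] .
  have B_carrier: "B \<in> carrier_mat (d * d) (d * d)" using B(1) by (rule psd_carrier)
  have H: "H = B * adj B" using B psd_imp_hermitian hermitian_adj by metis
  define N where "N k = mat d d (\<lambda>(i,a). B $$ (i * d + a, k))" for k
  have "H = msum (d * d) {..<d * d} (\<lambda>k. vec_proj d (N k))"
  proof (rule eq_mat_productI[OF psd_carrier[OF assms] msum_carrier])
    fix i a j b assume "i < d" "a < d" "j < d" "b < d"
    then show "H $$ (i * d + a, j * d + b)
        = msum (d * d) {..<d * d} (\<lambda>k. vec_proj d (N k)) $$ (i * d + a, j * d + b)"
      unfolding H using B_carrier
      by (subst index_mult_mat_sum[of _ "d * d" "d * d" _ "d * d"])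
        (auto simp: N_def product_index_less)
  qed
  moreover have "N k \<in> carrier_mat d d" for k by (simp add: N_def)
  ultimately show thesis using that by blast
qed

lemma ptrace_A_vec_proj:
  assumes "M \<in> carrier_mat d d" shows "ptrace_A d (vec_proj d M) = M * adj M"
  using assms by (intro eq_matI)
    (auto simp: ptrace_A_def index_mult_mat_sum[of M d d "adj M" d])

lemma ptrace_S_vec_proj:
  assumes "M \<in> carrier_mat d d" shows "ptrace_S d (vec_proj d M) = (adj M * M)\<^sup>T"
  using assms by (intro eq_matI)
    (auto simp: ptrace_S_def index_mult_mat_sum[of "adj M" d d M d] mult.commute)

lemma psd_ptrace_vec_proj:
  assumes "M \<in> carrier_mat d d" "ptr \<in> {ptrace_A d, ptrace_S d}"
  shows "psd d (ptr (vec_proj d M))"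
  using assms psd_mult_adj[OF assms(1)] psd_transpose[OF psd_adj_mult[OF assms(1)]]
  by (auto simp: ptrace_A_vec_proj ptrace_S_vec_proj)

lemma purity_gap_ptrace_vec_proj:
  assumes "M \<in> carrier_mat d d" "ptr \<in> {ptrace_A d, ptrace_S d}"
  shows "purity_gap (ptr (vec_proj d M)) = purity_gap (adj M * M)"
  using assms purity_gap_mult_commute[OF assms(1) adj_carrier[OF assms(1)]]
    purity_gap_transpose[OF psd_carrier[OF psd_adj_mult[OF assms(1)]]]
  by (auto simp: ptrace_A_vec_proj ptrace_S_vec_proj)

lemma psd_ptrace:
  assumes "psd (d * d) H" "ptr \<in> {ptrace_A d, ptrace_S d}" shows "psd d (ptr H)"
proof -
  obtain N where N: "\<And>k. N k \<in> carrier_mat d d" "H = msum (d * d) {..<d * d} (\<lambda>k. vec_proj d (N k))"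
    using psd_vec_proj_decomposition[OF assms(1)] by blast
  then show ?thesis
    using assms(2) by (simp add: ptrace_msum psd_msum psd_ptrace_vec_proj)
qed

lemma ptrans_A_vec_proj_square:
  assumes M: "M \<in> carrier_mat d d"
  shows "ptrans_A d (vec_proj d M) * ptrans_A d (vec_proj d M) = kron (M * adj M) (adj M * M)"
    (is "?A * ?A = _")
proof (rule eq_mat_productI)
  have MM_carrier: "M * adj M \<in> carrier_mat d d" "adj M * M \<in> carrier_mat d d" using M by auto
  then show "kron (M * adj M) (adj M * M) \<in> carrier_mat (d * d) (d * d)" by (rule kron_carrier)
  show "?A * ?A \<in> carrier_mat (d * d) (d * d)" by simp
  fix i a j b assume ij: "i < d" "a < d" "j < d" "b < d"
  have "(?A * ?A) $$ (i * d + a, j * d + b)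
      = (\<Sum>k<d. \<Sum>c<d. ?A $$ (i * d + a, k * d + c) * ?A $$ (k * d + c, j * d + b))"
    using ij by (subst index_mult_mat_sum[OF ptrans_A_carrier ptrans_A_carrier])
      (auto simp: product_index_less sum_product_index)
  also have "\<dots> = (\<Sum>k<d. \<Sum>c<d. (M $$ (i,c) * cnj (M $$ (k,a))) * (M $$ (k,b) * cnj (M $$ (j,c))))"
    using ij by (intro sum.cong refl) (simp add: index_ptrans_A)
  also have "\<dots> = (\<Sum>k<d. cnj (M $$ (k,a)) * M $$ (k,b)) * (\<Sum>c<d. M $$ (i,c) * cnj (M $$ (j,c)))"
    by (simp add: sum_product mult_ac)
  also have "\<dots> = (adj M * M) $$ (a,b) * (M * adj M) $$ (i,j)"
    using M ij by (simp add: index_mult_mat_sum[of _ d d _ d])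
  also have "\<dots> = kron (M * adj M) (adj M * M) $$ (i * d + a, j * d + b)"
    unfolding index_kron[OF MM_carrier ij] by (rule mult.commute)
  finally show "(?A * ?A) $$ (i * d + a, j * d + b)
      = kron (M * adj M) (adj M * M) $$ (i * d + a, j * d + b)" .
qed

lemma trace_norm_ptrans_A_vec_proj:
  assumes M: "M \<in> carrier_mat d d"
  shows "trace_norm (ptrans_A d (vec_proj d M)) = trace_norm (adj M) * trace_norm M"
proof -
  let ?A = "ptrans_A d (vec_proj d M)"
  obtain R where R: "psd d R" "R * R = M * adj M" and norm_R: "trace_norm (adj M) = Re (mtrace R)"
    using trace_norm_psd_sqrt[OF adj_carrier[OF M]] by auto
  obtain S where S: "psd d S" "S * S = adj M * M" and norm_S: "trace_norm M = Re (mtrace S)"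
    using trace_norm_psd_sqrt[OF M] .
  have carrier: "R \<in> carrier_mat d d" "S \<in> carrier_mat d d" using R S psd_carrier by auto
  have "adj ?A = ?A" using hermitian_adj hermitian_ptrans_A hermitian_vec_proj by blast
  then have "kron R S * kron R S = adj ?A * ?A"
    using carrier
    by (simp add: kron_mult[of _ d d _ d _ d d _ d] R S ptrans_A_vec_proj_square[OF M])
  then have "trace_norm ?A = Re (mtrace (kron R S))"
    using psd_kron[OF R(1) S(1)] by (intro trace_norm_eqI[OF ptrans_A_carrier])
  then show ?thesis
    using psd_mtrace_nonneg[OF R(1)]
    by (simp add: mtrace_kron[OF carrier] norm_R norm_S less_eq_complex_def)
qed

lemma trace_norm_ptrans_A_vec_proj_le:
  assumes M: "M \<in> carrier_mat d d"
  shows "trace_norm (ptrans_A d (vec_proj d M))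
    \<le> Re (mtrace (adj M * M)) + sqrt (real d * (real d - 1)) * sqrt (purity_gap (adj M * M))"
    (is "_ \<le> ?bound")
proof -
  have "trace_norm (ptrans_A d (vec_proj d M)) \<le> ((trace_norm (adj M))\<^sup>2 + (trace_norm M)\<^sup>2) / 2"
    using sum_squares_bound[of "trace_norm (adj M)" "trace_norm M"]
    by (simp add: trace_norm_ptrans_A_vec_proj[OF M])
  moreover have "(trace_norm (adj M))\<^sup>2 \<le> ?bound"
    using square_trace_norm_le[OF adj_carrier[OF M]] mtrace_mult_commute[OF M adj_carrier[OF M]]
      purity_gap_mult_commute[OF M adj_carrier[OF M]] by simp
  moreover have "(trace_norm M)\<^sup>2 \<le> ?bound" using M by (rule square_trace_norm_le)
  ultimately show ?thesis by simp
qed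

subsection \<open>Classical memory\<close>

lemma trace_norm_ptrans_A_le:
  assumes H: "psd (d * d) H" and ptr: "ptr \<in> {ptrace_A d, ptrace_S d}"
  shows "trace_norm (ptrans_A d H)
    \<le> Re (mtrace H) + sqrt (real d * (real d - 1)) * sqrt (purity_gap (ptr H))"
proof -
  let ?s = "sqrt (real d * (real d - 1))"
  have factor: "0 \<le> ?s" by (cases d) auto
  obtain N where N: "\<And>k. N k \<in> carrier_mat d d"
    and H_eq: "H = msum (d * d) {..<d * d} (\<lambda>k. vec_proj d (N k))"
    using psd_vec_proj_decomposition[OF H] by blast
  let ?V = "\<lambda>k. vec_proj d (N k)"
  have pure: "trace_norm (ptrans_A d (?V k))
      \<le> Re (mtrace (?V k)) + ?s * sqrt (purity_gap (ptr (?V k)))" for k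
    using trace_norm_ptrans_A_vec_proj_le[OF N, of k]
      mtrace_ptrace[OF vec_proj_carrier, of "ptrace_A d" d "N k"]
      mtrace_mult_commute[OF N adj_carrier[OF N], of k]
    by (simp add: purity_gap_ptrace_vec_proj[OF N ptr] ptrace_A_vec_proj[OF N])
  have "trace_norm (ptrans_A d H) \<le> (\<Sum>k<d * d. trace_norm (ptrans_A d (?V k)))"
    unfolding H_eq ptrans_A_msum
    by (intro trace_norm_msum_le hermitian_ptrans_A hermitian_vec_proj finite_lessThan)
  also have "\<dots> \<le> (\<Sum>k<d * d. Re (mtrace (?V k)) + ?s * sqrt (purity_gap (ptr (?V k))))"
    by (intro sum_mono pure)
  also have "\<dots> = Re (mtrace H) + ?s * (\<Sum>k<d * d. sqrt (purity_gap (ptr (?V k))))"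
    by (simp add: H_eq mtrace_msum sum.distrib sum_distrib_left)
  also have "\<dots> \<le> Re (mtrace H) + ?s * sqrt (purity_gap (ptr H))"
    unfolding H_eq ptrace_msum[OF ptr]
    by (intro add_left_mono mult_left_mono sqrt_purity_gap_msum psd_ptrace_vec_proj[OF N ptr]
        finite_lessThan factor)
  finally show ?thesis .
qed

lemma realizable_classical_decomposition:
  assumes \<rho>: "psd (d * n) \<rho>" and classical: "realizable_classical d E1 E2"
  obtains I :: "nat set" and \<Phi> H where "finite I"
    "\<And>i. i \<in> I \<Longrightarrow> CPT d (\<Phi> i)" "\<And>i. i \<in> I \<Longrightarrow> psd (d * n) (H i)"
    "ext_id d n E1 \<rho> = msum (d * n) I H"
    "ext_id d n E2 \<rho> = msum (d * n) I (\<lambda>i. ext_id d n (\<Phi> i) (H i))"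
proof -
  obtain I :: "nat set" and K \<Phi> where I: "finite I"
    and K: "\<And>i. i \<in> I \<Longrightarrow> K i \<in> carrier_mat d d" and \<Phi>: "\<And>i. i \<in> I \<Longrightarrow> CPT d (\<Phi> i)"
    and E1: "\<And>X. X \<in> carrier_mat d d \<Longrightarrow> E1 X = msum d I (\<lambda>i. K i * X * adj (K i))"
    and E2: "\<And>X. X \<in> carrier_mat d d \<Longrightarrow> E2 X = msum d I (\<lambda>i. \<Phi> i (K i * X * adj (K i)))"
    using classical unfolding realizable_classical_def by blast
  define H where "H i = ext_id d n (\<lambda>X. K i * X * adj (K i)) \<rho>" for i
  have "psd (d * n) (H i)" if "i \<in> I" for i
    unfolding H_def using K[OF that] \<rho> by (rule psd_ext_id_conjugation)
  moreover have "ext_id d n E1 \<rho> = msum (d * n) I H"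
    unfolding H_def using E1 by (rule ext_id_eq_msum)
  moreover have "ext_id d n E2 \<rho>
      = msum (d * n) I (\<lambda>i. ext_id d n (\<lambda>X. \<Phi> i (K i * X * adj (K i))) \<rho>)"
    using E2 by (rule ext_id_eq_msum)
  then have "ext_id d n E2 \<rho> = msum (d * n) I (\<lambda>i. ext_id d n (\<Phi> i) (H i))"
    unfolding H_def using K by (subst (asm) msum_cong[OF ext_id_comp]) auto
  ultimately show thesis using that I \<Phi> by blast
qed

lemma classical_memory_trace_norm_le:
  assumes \<rho>: "psd (d * d) \<rho>" and classical: "realizable_classical d E1 E2"
    and ptr: "ptr \<in> {ptrace_A d, ptrace_S d}"
  shows "trace_norm (ptrans_A d (ext_id d d E2 \<rho>)) \<le> Re (mtrace (ext_id d d E1 \<rho>))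
      + sqrt (real d * (real d - 1)) * sqrt (purity_gap (ptr (ext_id d d E1 \<rho>)))"
proof -
  let ?s = "sqrt (real d * (real d - 1))"
  have factor: "0 \<le> ?s" by (cases d) auto
  obtain I :: "nat set" and \<Phi> H where I: "finite I" and \<Phi>: "\<And>i. i \<in> I \<Longrightarrow> CPT d (\<Phi> i)"
    and H: "\<And>i. i \<in> I \<Longrightarrow> psd (d * d) (H i)" and \<rho>1: "ext_id d d E1 \<rho> = msum (d * d) I H"
    and \<rho>2: "ext_id d d E2 \<rho> = msum (d * d) I (\<lambda>i. ext_id d d (\<Phi> i) (H i))"
    using realizable_classical_decomposition[OF \<rho> classical] by metis
  define T where "T i = ptrans_A d (H i)" for i
  have ptrans: "ptrans_A d (ext_id d d E2 \<rho>) = msum (d * d) I (\<lambda>i. ext_id d d (\<Phi> i) (T i))"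
    by (simp add: \<rho>2 ptrans_A_msum ptrans_A_ext_id T_def)
  have T: "hermitian (d * d) (T i)" if "i \<in> I" for i
    unfolding T_def using H[OF that] by (intro hermitian_ptrans_A psd_imp_hermitian)
  have "trace_norm (ptrans_A d (ext_id d d E2 \<rho>)) \<le> (\<Sum>i\<in>I. trace_norm (ext_id d d (\<Phi> i) (T i)))"
    unfolding ptrans by (intro trace_norm_msum_le I hermitian_ext_id \<Phi> T)
  also have "\<dots> \<le> (\<Sum>i\<in>I. trace_norm (T i))"
    by (intro sum_mono trace_norm_ext_id_le \<Phi> T)
  also have "\<dots> \<le> (\<Sum>i\<in>I. Re (mtrace (H i)) + ?s * sqrt (purity_gap (ptr (H i))))"
    unfolding T_def by (intro sum_mono trace_norm_ptrans_A_le H ptr)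
  also have "\<dots> = Re (mtrace (ext_id d d E1 \<rho>)) + ?s * (\<Sum>i\<in>I. sqrt (purity_gap (ptr (H i))))"
    using H by (simp add: \<rho>1 mtrace_msum psd_carrier sum.distrib sum_distrib_left)
  also have "\<dots> \<le> Re (mtrace (ext_id d d E1 \<rho>)) + ?s * sqrt (purity_gap (ptr (ext_id d d E1 \<rho>)))"
    unfolding \<rho>1 ptrace_msum[OF ptr]
    by (intro add_left_mono mult_left_mono sqrt_purity_gap_msum I psd_ptrace[OF H ptr] factor)
  finally show ?thesis .
qed

lemma classical_memory_linear_entropy_bound:
  assumes d: "d \<ge> 2" and E1: "CPT d E1" and E2: "CPT d E2" and \<rho>: "density (d * d) \<rho>"
    and classical: "realizable_classical d E1 E2" and ptr: "ptr \<in> {ptrace_A d, ptrace_S d}"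
  defines "\<rho>1 \<equiv> ext_id d d E1 \<rho>" and "\<rho>2 \<equiv> ext_id d d E2 \<rho>"
  shows "sqrt (2 / (real d * (real d - 1)))
      * max (trace_norm (ptrans_S d \<rho>2) - 1) (trace_norm (ptrans_A d \<rho>2) - 1)
    \<le> sqrt (2 * (1 - Re (mtrace (ptr \<rho>1 * ptr \<rho>1))))"
    (is "_ * ?N \<le> _")
proof -
  define D where "D = real d * (real d - 1)"
  have D: "0 < D" using d by (simp add: D_def)
  have psd: "psd (d * d) \<rho>" and "mtrace \<rho> = 1" using \<rho> by (auto simp: density_def)
  then have trace_state: "mtrace \<rho>1 = 1" by (simp add: \<rho>1_def mtrace_ext_id[OF E1] psd_carrier)
  then have trace_ptr: "mtrace (ptr \<rho>1) = 1"
  by (simp add: \<rho>1_def mtrace_ptrace[OF ext_id_carrier ptr])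
  note bound = classical_memory_trace_norm_le[OF psd classical ptr, folded \<rho>1_def \<rho>2_def D_def]
  have "hermitian (d * d) (ptrans_A d \<rho>2)"
    unfolding \<rho>2_def by (intro hermitian_ptrans_A psd_imp_hermitian CPT_psd_ext_id E2 psd)
  then have "trace_norm (ptrans_S d \<rho>2) \<le> trace_norm (ptrans_A d \<rho>2)"
    unfolding ptrans_S_eq_transpose by (rule trace_norm_transpose_le)
  then have "?N \<le> sqrt D * sqrt (purity_gap (ptr \<rho>1))"
    using bound by (simp add: trace_state)
  then have "sqrt (2 / D) * ?N \<le> sqrt (2 / D) * (sqrt D * sqrt (purity_gap (ptr \<rho>1)))"
    using D by (intro mult_left_mono) auto
  also have "\<dots> = sqrt (2 / D * D * purity_gap (ptr \<rho>1))"
    by (simp only: real_sqrt_mult mult.assoc)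
  also have "2 / D * D * purity_gap (ptr \<rho>1) = 2 * (1 - Re (mtrace (ptr \<rho>1 * ptr \<rho>1)))"
    using D by (simp add: purity_gap_def trace_ptr)
  finally show ?thesis unfolding D_def .
qed

theorem theorem1:
  fixes d :: nat and E1 E2 :: "complex mat \<Rightarrow> complex mat" and \<rho>0 :: "complex mat"
  assumes "d \<ge> 2"
    and "CPT d E1" and "CPT d E2"
    and "density (d*d) \<rho>0"
    and "Delta d E1 E2 \<rho>0 > 0"
  shows "\<not> realizable_classical d E1 E2"
proof
  assume classical: "realizable_classical d E1 E2"
  note bound = classical_memory_linear_entropy_bound[OF assms(1-4) classical]
  have "0 \<le> F_Delta d E1 E2 \<rho>0"
    unfolding F_Delta_def Let_def using bound[of "ptrace_A d"] bound[of "ptrace_S d"] by simp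
  then show False using assms(5) by (simp add: Delta_def)
qed

end
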